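(* For every integer $d\ge 1$ with $d\ne 3$, the graph of a $d$-cube is $\lfloor (d+1)/2\rfloor$-linked.
   Context: A $d$-cube is a polytope combinatorially equivalent to the convex hull in $\mathbb{R}^d$ of the $2^d$ vectors $(\pm1,\ldots,\pm1)$. The graph of a polytope is the undirected graph formed by its vertices and edges; the graph of a $d$-cube is the usual hypercube graph on $2^d$ vertices, in which two vertices are adjacent iff they differ in exactly one coordinate. A graph $G$ is $k$-linked if it has at least $2k$ vertices and, for every set of $2k$ distinct vertices of $G$ and every partition of this set into $k$ pairs $\{s_1,t_1\},\ldots,\{s_k,t_k\}$, there exist $k$ pairwise vertex-disjoint paths $L_1,\ldots,L_k$ in $G$ such that $L_i$ joins $s_i$ and $t_i$ for each $i$. *)

theory Defs
  imports "HOL-Analysis.Analysis" "Graph_Theory.Graph_Theory"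
begin

definition cube_polytope :: "(real ^ 'n) set" where
  "cube_polytope = convex hull {x. \<forall>i. x $ i \<in> {-1, 1}}"

(* face_of admits {} and the whole set as faces, so this is isomorphism of full face lattices. *)
definition comb_equiv :: "'a::euclidean_space set \<Rightarrow> 'b::euclidean_space set \<Rightarrow> bool" where
  "comb_equiv P Q \<longleftrightarrow>
     (\<exists>\<phi>. bij_betw \<phi> {F. F face_of P} {F. F face_of Q} \<and>
          (\<forall>F G. F face_of P \<longrightarrow> G face_of P \<longrightarrow> (F \<subseteq> G \<longleftrightarrow> \<phi> F \<subseteq> \<phi> G)))"

(* An undirected graph is represented, as usual in Graph_Theory, by a symmetric digraph:
   each edge of the polytope contributes both arcs between its endpoints. *)
definition polytope_graph :: "'a::euclidean_space set \<Rightarrow> 'a pair_pre_digraph" where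
  "polytope_graph P =
     \<lparr> pverts = {v. v extreme_point_of P},
       parcs = {(v, w). v extreme_point_of P \<and> w extreme_point_of P \<and>
                        closed_segment v w edge_of P} \<rparr>"

lemma pair_graph_polytope_graph:
  assumes "polytope P"
  shows "pair_graph (polytope_graph P)"
proof -
  have fin: "finite {v. v extreme_point_of P}"
    using assms finite_polyhedron_extreme_points polytope_imp_polyhedron by blast
  have "finite (parcs (polytope_graph P))"
    by (rule finite_subset[OF _ finite_cartesian_product[OF fin fin]])
       (auto simp: polytope_graph_def)
  with fin show ?thesis
    by unfold_locales
       (auto simp: polytope_graph_def edge_of_def symmetric_def closed_segment_commute intro!: symI)
qed

(* The 2k distinct vertices and their partition into pairs are given by
   enumerations s, t of the pairs {s i, t i}, i < k. Meant for finite graphs: card is 0 on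
   infinite vertex sets. *)
definition k_linked :: "nat \<Rightarrow> ('a, 'b) pre_digraph \<Rightarrow> bool" where
  "k_linked k G \<longleftrightarrow>
     2 * k \<le> card (verts G) \<and>
     (\<forall>s t. s ` {..<k} \<subseteq> verts G \<and> t ` {..<k} \<subseteq> verts G \<and>
            inj_on s {..<k} \<and> inj_on t {..<k} \<and> s ` {..<k} \<inter> t ` {..<k} = {} \<longrightarrow>
        (\<exists>L. (\<forall>i<k. vpath (L i) G \<and> hd (L i) = s i \<and> last (L i) = t i) \<and>
             (\<forall>i<k. \<forall>j<k. i \<noteq> j \<longrightarrow> set (L i) \<inter> set (L j) = {})))"

end

theory Submission
  imports Defs
begin

text \<open>
  The graph of \<open>P\<close> can be read off its face lattice: the vertices are the one-point faces, and two
  of them are adjacent once some face contains these two vertices and no others.  Hence a lattice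
  isomorphism carries the cube graph into the graph of \<open>P\<close>, bijectively on vertices
  (\<open>cube_graph_in_polytope_graph\<close>).  It remains to link terminals in the graph on
  \<open>'i \<Rightarrow> bool\<close> in which neighbours differ in one coordinate.

  The induction on the dimension \<open>d\<close> proves slightly more than linkedness.  A pair with
  \<open>s k = t k\<close> is allowed; it merely reserves a vertex that the other paths have to avoid.  The claim
  \<open>linkable_subcube\<close> is that for \<open>d \<noteq> 3\<close> disjoint pairs with at most \<open>d + 1\<close> terminals in all can
  be linked.  For even \<open>d\<close> this leaves room for one reserved vertex besides \<open>d div 2\<close> pairs, and the
  step from \<open>d\<close> to \<open>d + 1\<close> needs that vertex.

  For the step, a direction \<open>x\<close> splits a \<open>(d + 1)\<close>-cube with at most \<open>d + 2\<close> terminals into two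
  facets, each of which can cope with \<open>d + 1\<close> of them.  A pair with one end in each facet is routed
  from its end \<open>s k\<close> to a vertex \<open>r k\<close>, equal or adjacent to it, whose copy in the other facet is free or \<open>t k\<close>,
  and is linked there.  Such detours always exist (\<open>detour_exists\<close>).  If some
  pair stays inside the first facet and, moreover, the second facet has a pair of its own or some
  crossing pair needs no detour, then both facets stay within their bound.  Up to exchanging the
  facets, two situations remain, in which the bound may be exceeded by one.  If every pair crosses, one
  pair is linked in the first facet and the rest in the second (\<open>link_all_crossing\<close>).  If one facet
  has no pair of its own and all crossing pairs need detours, one terminal is ignored at first:
  it lies on at most one of the paths found, and of the two pairs concerned those inside the
  facet are taken through the other one (\<open>link_all_but_two\<close>, \<open>link_with_near_pair\<close>).
  Both repairs require a direction in which few terminals are adjacent, and the cube graph being bipartite provides one as soon as the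
  cube has dimension at least 5 (\<open>sparse_direction\<close>).

  Dimensions up to 2 leave only one proper pair, so connectivity suffices.  In dimension 3 two pairs
  alternating around a square cannot be linked, so dimension 4 has to be obtained from facets in
  which only one proper pair may be linked (\<open>linkable_4\<close>).
\<close>

section \<open>The graph of the cube\<close>

definition flip :: "'i \<Rightarrow> ('i \<Rightarrow> bool) \<Rightarrow> 'i \<Rightarrow> bool" where
  "flip x v = v(x := \<not> v x)"

definition adj :: "('i \<Rightarrow> bool) \<Rightarrow> ('i \<Rightarrow> bool) \<Rightarrow> bool" where
  "adj u v \<longleftrightarrow> (\<exists>x. v = flip x u)"

text \<open>The face of the cube through \<open>w\<close> spanned by the directions in \<open>J\<close>.  Faces are kept as subsets of one
fixed cube, so that the two facets of a face are faces again and share one adjacency relation.\<close>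

definition subcube :: "'i set \<Rightarrow> ('i \<Rightarrow> bool) \<Rightarrow> ('i \<Rightarrow> bool) set" where
  "subcube J w = {v. \<forall>i. i \<notin> J \<longrightarrow> v i = w i}"

text \<open>Connectedness by a path inside \<open>C\<close>.  A linkage is a family of disjoint vertex sets rather than of
paths, so that concatenating paths is taking unions; actual paths are extracted only at the very end.\<close>

definition joined :: "('i \<Rightarrow> bool) set \<Rightarrow> ('i \<Rightarrow> bool) \<Rightarrow> ('i \<Rightarrow> bool) \<Rightarrow> bool" where
  "joined C u v \<longleftrightarrow> u \<in> C \<and> (\<lambda>a b. adj a b \<and> b \<in> C)\<^sup>*\<^sup>* u v"

lemma flip_flip [simp]: "flip x (flip x v) = v"
  by (auto simp: flip_def)

lemma flip_same [simp]: "flip x v x \<longleftrightarrow> \<not> v x"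
  by (auto simp: flip_def)

lemma flip_other [simp]: "i \<noteq> x \<Longrightarrow> flip x v i = v i"
  by (auto simp: flip_def)

lemma flip_neq [simp]: "flip x v \<noteq> v" "v \<noteq> flip x v"
  by (metis flip_same)+

lemma flip_inject [simp]: "flip x u = flip x v \<longleftrightarrow> u = v"
  by (metis flip_flip)

lemma flip_dir_inject [simp]: "flip x v = flip y v \<longleftrightarrow> x = y"
  by (metis flip_other flip_same)

lemma flip_swap: "flip x v = u \<longleftrightarrow> v = flip x u"
  by auto

lemma adj_sym: "adj u v \<Longrightarrow> adj v u"
  unfolding adj_def by (metis flip_flip)

lemma adj_flip [simp, intro]: "adj v (flip x v)" "adj (flip x v) v"
  unfolding adj_def by (metis flip_flip)+

lemma joined_refl: "u \<in> C \<Longrightarrow> joined C u u"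
  by (simp add: joined_def)

lemma joined_edge: "adj u v \<Longrightarrow> u \<in> C \<Longrightarrow> v \<in> C \<Longrightarrow> joined C u v"
  by (auto simp: joined_def)

lemma joined_step: "u = v \<or> adj u v \<Longrightarrow> u \<in> C \<Longrightarrow> v \<in> C \<Longrightarrow> joined C u v"
  using joined_refl joined_edge by metis

lemma joined_trans: "joined C u v \<Longrightarrow> joined C v w \<Longrightarrow> joined C u w"
  by (auto simp: joined_def)

lemma joined_mono: assumes "joined C u v" "C \<subseteq> D" shows "joined D u v"
proof -
  have "(\<lambda>a b. adj a b \<and> b \<in> D)\<^sup>*\<^sup>* u v"
    using assms by (auto simp: joined_def elim!: rtranclp_mono[THEN predicate2D, rotated])
  then show ?thesis using assms by (auto simp: joined_def)
qed

lemma joined_in: assumes "joined C u v" shows "u \<in> C" "v \<in> C"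
proof -
  show "u \<in> C" using assms by (simp add: joined_def)
  have "(\<lambda>a b. adj a b \<and> b \<in> C)\<^sup>*\<^sup>* u v" using assms by (simp add: joined_def)
  then show "v \<in> C" by (cases rule: rtranclp.cases) (use \<open>u \<in> C\<close> in auto)
qed

lemma joined_sym: assumes "joined C u v" shows "joined C v u"
proof -
  have u: "u \<in> C" using assms by (simp add: joined_def)
  have "(\<lambda>a b. adj a b \<and> b \<in> C)\<^sup>*\<^sup>* u v" using assms by (simp add: joined_def)
  then show ?thesis
  proof induction
    case base then show ?case using u by (rule joined_refl)
  next
    case (step y z)
    then have "joined C z y" by (meson adj_sym joined_edge joined_in)
    then show ?case using step.IH joined_trans by blast
  qed
qed

lemma subcube_self [simp]: "w \<in> subcube J w"
  by (simp add: subcube_def)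

lemma subcube_eq: "v \<in> subcube J w \<Longrightarrow> subcube J v = subcube J w"
  by (auto simp: subcube_def)

lemma subcube_flip: "x \<in> J \<Longrightarrow> flip x v \<in> subcube J w \<longleftrightarrow> v \<in> subcube J w"
  unfolding subcube_def flip_def by (auto split: if_splits)

lemma subcube_insert_split:
  "subcube (insert x J) w = subcube J w \<union> subcube J (flip x w)"
proof (rule set_eqI)
  fix v
  show "v \<in> subcube (insert x J) w \<longleftrightarrow> v \<in> subcube J w \<union> subcube J (flip x w)"
  proof (cases "v x = w x")
    case True then show ?thesis by (force simp: subcube_def flip_def)
  next
    case False then show ?thesis by (force simp: subcube_def flip_def)
  qed
qed

lemma facets_disjoint:
  "x \<notin> J \<Longrightarrow> subcube J w \<inter> subcube J (flip x w) = {}"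
  by (force simp: subcube_def flip_def)

lemma flip_facet:
  assumes "x \<notin> J"
  shows "flip x v \<in> subcube J (flip x w) \<longleftrightarrow> v \<in> subcube J w"
    and "flip x v \<in> subcube J w \<longleftrightarrow> v \<in> subcube J (flip x w)"
  using assms unfolding subcube_def flip_def by (auto split: if_splits)

lemma facet_iff:
  assumes "x \<notin> J" "v \<in> subcube (insert x J) u"
  shows "v \<in> subcube J u \<longleftrightarrow> v x = u x" "v \<in> subcube J (flip x u) \<longleftrightarrow> v x \<noteq> u x"
proof -
  have v: "v i = u i" if "i \<notin> J" "i \<noteq> x" for i using assms(2) that by (simp add: subcube_def)
  show "v \<in> subcube J u \<longleftrightarrow> v x = u x"
    using v assms(1) unfolding subcube_def mem_Collect_eq by metis
  show "v \<in> subcube J (flip x u) \<longleftrightarrow> v x \<noteq> u x"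
    using v assms(1) unfolding subcube_def mem_Collect_eq by (metis flip_other flip_same)
qed

lemma finite_vertices [simp]: "finite (A :: ('i::finite \<Rightarrow> bool) set)"
  by simp

text \<open>The bipartition of the cube graph.\<close>

definition even_vertex :: "('i::finite \<Rightarrow> bool) \<Rightarrow> bool" where
  "even_vertex v \<longleftrightarrow> even (card {i. v i})"

lemma even_vertex_flip [simp]:
  fixes v :: "'i::finite \<Rightarrow> bool"
  shows "even_vertex (flip x v) \<longleftrightarrow> \<not> even_vertex v"
proof -
  have *: "even_vertex (flip x v) \<longleftrightarrow> \<not> even_vertex v" if "\<not> v x" for v :: "'i \<Rightarrow> bool"
  proof -
    have "{i. flip x v i} = insert x {i. v i}" using that by (auto simp: flip_def)
    then show ?thesis using that by (simp add: even_vertex_def)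
  qed
  show ?thesis using *[of v] *[of "flip x v"] by (cases "v x") auto
qed

text \<open>The cube of dimension \<open>d\<close> is \<open>d\<close>-connected.  In a direction separating \<open>u\<close> from \<open>v\<close>, step from \<open>u\<close>
to a vertex \<open>r\<close> equal or adjacent to it with a free copy across, cross over, and continue by
induction in the facet of \<open>v\<close>; this works if that facet does not contain all \<open>d - 1\<close> vertices that
may be forbidden.  If it does, the facet of \<open>u\<close> contains none, and the roles of \<open>u\<close> and \<open>v\<close> are swapped.\<close>

lemma subcube_connected:
  fixes J :: "'i::finite set"
  assumes "u \<in> subcube J w" "v \<in> subcube J w" "u \<notin> A" "v \<notin> A"
    and "card A < card J \<or> u = v"
  shows "joined (subcube J w - A) u v"
  using assms
proof (induction "card J" arbitrary: J u v w A)
  case 0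
  then show ?case by (auto intro: joined_refl)
next
  case (Suc d I)
  show ?case
  proof (cases "u = v")
    case True then show ?thesis using Suc.prems by (auto intro: joined_refl)
  next
    case False
    then obtain x where x: "u x \<noteq> v x" by auto
    define J where "J = I - {x}"
    have xI: "x \<in> I" using x Suc.prems by (auto simp: subcube_def)
    then have I: "I = insert x J" "x \<notin> J" by (auto simp: J_def)
    have cJ: "card J = d"
      using I Suc.hyps by simp
    have cA: "card A \<le> d"
      using Suc.prems False Suc.hyps by auto
    have one_way: "joined (subcube I w - A) p q"
      if p: "p \<in> subcube I w" "p \<notin> A" and q: "q \<in> subcube J (flip x p)" "q \<notin> A"
        and small: "card (A \<inter> subcube J (flip x p)) < d \<or> A = {}" for p q
    proof -
      have sub: "subcube J p \<subseteq> subcube I w" "subcube J (flip x p) \<subseteq> subcube I w"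
        using subcube_insert_split[of x J p] subcube_eq[OF p(1)] I by auto
      have "\<exists>r. r \<in> subcube J p \<and> (r = p \<or> adj p r) \<and> r \<notin> A \<and> flip x r \<notin> A"
      proof (cases "flip x p \<in> A")
        case False then show ?thesis using p by (intro exI[of _ p]) auto
      next
        case True
        \<comment> \<open>Every vertex of \<open>A\<close> spoils at most one of the \<open>d\<close> neighbours, and \<open>flip x p\<close> none.\<close>
        define N where "N = (\<lambda>y. flip y p) ` J"
        define B where "B = (\<lambda>a. if a x = p x then a else flip x a) ` (A - {flip x p})"
        have "card N = d" unfolding N_def using cJ by (subst card_image) (auto simp: inj_on_def)
        moreover have "card B < d"
        proof -
          have "card B \<le> card (A - {flip x p})" unfolding B_def by (rule card_image_le) simp
          also have "\<dots> < card A" using True by (intro card_Diff1_less) auto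
          finally show ?thesis using cA by simp
        qed
        ultimately obtain r where r: "r \<in> N" "r \<notin> B"
          by (metis card_mono finite_vertices linorder_not_less subsetI)
        then obtain y where y: "y \<in> J" "r = flip y p" by (auto simp: N_def)
        have rx: "r x = p x" using y I by (metis flip_other)
        have "r \<notin> A"
        proof
          assume a: "r \<in> A"
          then have "r \<in> A - {flip x p}" using rx by auto
          then have "r \<in> B" unfolding B_def using rx by force
          then show False using r by simp
        qed
        moreover have "flip x r \<notin> A"
        proof
          assume a: "flip x r \<in> A"
          then have "flip x r \<in> A - {flip x p}" using y by auto
          then have "r \<in> B" unfolding B_def using rx by (intro image_eqI[where x="flip x r"]) auto
          then show False using r by simp
        qed
        moreover have "r \<in> subcube J p" using y by (simp add: subcube_flip)
        moreover have "adj p r" using y by simp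
        ultimately show ?thesis by blast
      qed
      then obtain r where r: "r \<in> subcube J p" "r = p \<or> adj p r" "r \<notin> A" "flip x r \<notin> A"
        by blast
      have fr: "flip x r \<in> subcube J (flip x p)"
        using r I by (simp add: flip_facet)
      have "joined (subcube I w - A) p r"
        using r p sub by (intro joined_step) auto
      moreover have "joined (subcube I w - A) r (flip x r)"
        using r fr sub by (intro joined_edge) auto
      moreover have "joined (subcube J (flip x p) - (A \<inter> subcube J (flip x p))) (flip x r) q"
      proof (rule Suc.hyps(1))
        show "card (A \<inter> subcube J (flip x p)) < card J \<or> flip x r = q"
        proof (cases "d = 0")
          case True
          then have "J = {}" using cJ by simp
          then show ?thesis using fr q by (auto simp: subcube_def)
        next
          case False then show ?thesis using small cJ by auto
        qed
      qed (use cJ fr q r in auto)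
      then have "joined (subcube I w - A) (flip x r) q"
        by (rule joined_mono) (use sub in auto)
      ultimately show ?thesis using joined_trans by blast
    qed
    have facets: "v \<in> subcube J (flip x u)" "u \<in> subcube J (flip x v)"
      using Suc.prems x unfolding I subcube_def flip_def by auto
    show ?thesis
    proof (cases "card (A \<inter> subcube J (flip x u)) < d \<or> A = {}")
      case True
      then show ?thesis using one_way[of u v] facets Suc.prems by blast
    next
      case False
      then have "A \<inter> subcube J (flip x u) = A"
        using cA by (metis Int_lower1 card_seteq finite_vertices linorder_not_less order_trans)
      moreover have "subcube J (flip x u) \<inter> subcube J (flip x v) = {}"
      proof -
        have "subcube J (flip x v) = subcube J u" using facets(2) subcube_eq by blast
        then show ?thesis using facets_disjoint[of x J u] I by blast
      qed
      ultimately have "A \<inter> subcube J (flip x v) = {}" by blast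
      then have "card (A \<inter> subcube J (flip x v)) < d \<or> A = {}"
        using False cA by (cases d) auto
      then have "joined (subcube I w - A) v u" using one_way[of v u] facets Suc.prems by blast
      then show ?thesis by (rule joined_sym)
    qed
  qed
qed

section \<open>Families of terminals and linkages\<close>

text \<open>A family of terminal pairs is given by two functions on an index set \<open>K\<close>.  The two ends of a pair may
coincide: linking such a pair just reserves its vertex.\<close>

definition terminals :: "nat set \<Rightarrow> (nat \<Rightarrow> 'v) \<Rightarrow> (nat \<Rightarrow> 'v) \<Rightarrow> 'v set" where
  "terminals K s t = s ` K \<union> t ` K"

definition disjoint_pairs :: "nat set \<Rightarrow> (nat \<Rightarrow> 'v) \<Rightarrow> (nat \<Rightarrow> 'v) \<Rightarrow> bool" where
  "disjoint_pairs K s t \<longleftrightarrow> (\<forall>i\<in>K. \<forall>j\<in>K. i \<noteq> j \<longrightarrow> {s i, t i} \<inter> {s j, t j} = {})"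

definition linked ::
  "('i \<Rightarrow> bool) set \<Rightarrow> nat set \<Rightarrow> (nat \<Rightarrow> 'i \<Rightarrow> bool) \<Rightarrow> (nat \<Rightarrow> 'i \<Rightarrow> bool) \<Rightarrow> bool" where
  "linked V K s t \<longleftrightarrow> (\<exists>C. (\<forall>k\<in>K. C k \<subseteq> V \<and> joined (C k) (s k) (t k)) \<and>
                          (\<forall>i\<in>K. \<forall>j\<in>K. i \<noteq> j \<longrightarrow> C i \<inter> C j = {}))"

lemma linkedI:
  assumes "\<And>k. k \<in> K \<Longrightarrow> C k \<subseteq> V" "\<And>k. k \<in> K \<Longrightarrow> joined (C k) (s k) (t k)"
    and "\<And>i j. i \<in> K \<Longrightarrow> j \<in> K \<Longrightarrow> i \<noteq> j \<Longrightarrow> C i \<inter> C j = {}"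
  shows "linked V K s t"
  unfolding linked_def using assms by (intro exI[of _ C]) simp

lemma linkedE:
  assumes "linked V K s t"
  obtains C where "\<forall>k\<in>K. C k \<subseteq> V \<and> joined (C k) (s k) (t k)"
    "\<forall>i\<in>K. \<forall>j\<in>K. i \<noteq> j \<longrightarrow> C i \<inter> C j = {}"
  using assms unfolding linked_def by (elim exE conjE)

lemma linked_reorient:
  assumes L: "linked V K p q" and pairs: "\<forall>k\<in>K. p k = s k \<and> q k = t k \<or> p k = t k \<and> q k = s k"
  shows "linked V K s t"
proof -
  obtain C where C: "\<forall>k\<in>K. C k \<subseteq> V \<and> joined (C k) (p k) (q k)"
    "\<forall>i\<in>K. \<forall>j\<in>K. i \<noteq> j \<longrightarrow> C i \<inter> C j = {}"
    by (rule linkedE[OF L])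
  show ?thesis
  proof (rule linkedI[of _ C])
    fix k assume k: "k \<in> K"
    show "C k \<subseteq> V" using C(1) k by blast
    have "joined (C k) (p k) (q k)" using C(1) k by blast
    then show "joined (C k) (s k) (t k)" using bspec[OF pairs k] joined_sym by metis
  next
    show "C i \<inter> C j = {}" if "i \<in> K" "j \<in> K" "i \<noteq> j" for i j using C(2) that by blast
  qed
qed

lemma disjoint_pairsD:
  "disjoint_pairs K s t \<Longrightarrow> i \<in> K \<Longrightarrow> j \<in> K \<Longrightarrow> i \<noteq> j \<Longrightarrow>
    s i \<noteq> s j \<and> s i \<noteq> t j \<and> t i \<noteq> s j \<and> t i \<noteq> t j"
  unfolding disjoint_pairs_def by blast

lemma disjoint_pairs_finite:
  fixes s :: "nat \<Rightarrow> 'v::finite"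
  assumes "disjoint_pairs K s t"
  shows "finite K"
proof -
  have "inj_on s K" using assms unfolding disjoint_pairs_def inj_on_def by blast
  then show ?thesis by (rule finite_imageD[rotated]) simp
qed

lemma card_remove_pair:
  assumes "finite X" "a \<in> X" "b \<in> X" "a \<noteq> b"
  shows "card (X - {a, b}) + 2 = card X"
proof -
  have "card {a, b} \<le> card X" using assms by (intro card_mono) auto
  then show ?thesis using assms by (simp add: card_Diff_subset)
qed

text \<open>Adjacent or coinciding ends need no further vertices.  If only one pair \<open>h\<close> is left, connectivity
links it in the complement of all other terminals.  This is all that is available in dimension 3.\<close>

lemma linked_if_one_proper_pair:
  fixes J :: "'i::finite set"
  assumes disj: "disjoint_pairs K s t" and sub: "terminals K s t \<subseteq> subcube J w"
    and card: "card (terminals K s t) \<le> card J + 1"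
    and easy: "\<And>k. k \<in> K - {h} \<Longrightarrow> s k = t k \<or> adj (s k) (t k)"
  shows "linked (subcube J w) K s t"
proof -
  define A where "A = terminals K s t - {s h, t h}"
  define C where "C k = (if k = h then subcube J w - A else {s k, t k})" for k
  show ?thesis
  proof (rule linkedI[of _ C])
    fix k assume k: "k \<in> K"
    have st: "s k \<in> terminals K s t" "t k \<in> terminals K s t"
      using k by (auto simp: terminals_def)
    show "C k \<subseteq> subcube J w" using st sub by (auto simp: C_def)
    show "joined (C k) (s k) (t k)"
    proof (cases "k = h")
      case False
      then show ?thesis using easy[of k] k by (auto simp: C_def intro!: joined_step)
    next
      case True
      have "card A < card J \<or> s h = t h"
        using card card_remove_pair[of "terminals K s t" "s h" "t h"] st True
        by (auto simp: A_def)
      then have "joined (subcube J w - A) (s h) (t h)"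
        using st sub True by (intro subcube_connected) (auto simp: A_def)
      then show ?thesis using True by (simp add: C_def)
    qed
  next
    have "{s k, t k} \<subseteq> A" if "k \<in> K" "h \<in> K" "k \<noteq> h" for k
      using disjoint_pairsD[OF disj that] that by (auto simp: A_def terminals_def)
    then show "C i \<inter> C j = {}" if "i \<in> K" "j \<in> K" "i \<noteq> j" for i j
      using disjoint_pairsD[OF disj that] that by (auto simp: C_def)
  qed
qed

section \<open>Two facets and the pairs crossing between them\<close>

text \<open>Greedy choice: picking the representatives one after the other, only earlier choices of the
same colour \<open>p\<close> can block the next one.\<close>

lemma distinct_representatives:
  fixes Z :: "nat \<Rightarrow> 'v::finite set"
  assumes "finite B"
    and "\<And>j k. j \<in> B \<Longrightarrow> k \<in> B \<Longrightarrow> p j \<noteq> p k \<Longrightarrow> Z j \<inter> Z k = {}"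
    and "\<And>k. k \<in> B \<Longrightarrow> card {j \<in> B. p j = p k} \<le> card (Z k)"
  shows "\<exists>f. inj_on f B \<and> (\<forall>k\<in>B. f k \<in> Z k)"
  using assms
proof (induction B rule: finite_induct)
  case (insert b B)
  have "\<exists>f. inj_on f B \<and> (\<forall>k\<in>B. f k \<in> Z k)"
  proof (rule insert.IH)
    show "Z j \<inter> Z k = {}" if "j \<in> B" "k \<in> B" "p j \<noteq> p k" for j k
      using insert.prems(1)[of j k] that by blast
    show "card {j \<in> B. p j = p k} \<le> card (Z k)" if "k \<in> B" for k
    proof -
      have "card {j \<in> B. p j = p k} \<le> card {j \<in> insert b B. p j = p k}"
        using insert.hyps by (intro card_mono) auto
      then show ?thesis using insert.prems(2)[of k] that by simp
    qed
  qed
  then obtain f where f: "inj_on f B" "\<forall>k\<in>B. f k \<in> Z k" by blast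
  have "card (f ` {j \<in> B. p j = p b}) \<le> card {j \<in> B. p j = p b}"
    using insert.hyps by (intro card_image_le) auto
  also have "\<dots> < card {j \<in> insert b B. p j = p b}"
    using insert.hyps by (intro psubset_card_mono) auto
  also have "\<dots> \<le> card (Z b)" using insert.prems(2)[of b] by simp
  finally have lt: "card (f ` {j \<in> B. p j = p b}) < card (Z b)" .
  have "\<not> Z b \<subseteq> f ` {j \<in> B. p j = p b}"
  proof
    assume "Z b \<subseteq> f ` {j \<in> B. p j = p b}"
    then have "card (Z b) \<le> card (f ` {j \<in> B. p j = p b})" by (rule card_mono[rotated]) simp
    then show False using lt by simp
  qed
  then obtain z where z: "z \<in> Z b" "z \<notin> f ` {j \<in> B. p j = p b}" by blast
  have "f j \<noteq> z" if "j \<in> B" for j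
  proof (cases "p j = p b")
    case True
    then show ?thesis using z that by blast
  next
    case False
    then show ?thesis using z insert.prems(1)[of j b] f(2) that by blast
  qed
  then have "inj_on (f(b := z)) (insert b B) \<and> (\<forall>k\<in>insert b B. (f(b := z)) k \<in> Z k)"
    using f z insert.hyps by (auto simp: inj_on_def)
  then show ?case by blast
qed simp

text \<open>The two facets of \<open>subcube (insert x J) w\<close> in direction \<open>x\<close>.  Pairs with an end in each facet are
oriented so that \<open>s k\<close> lies in the near facet \<open>F0\<close> and \<open>t k\<close> in the far facet \<open>F1\<close>.\<close>

locale facet_split =
  fixes J :: "'i::finite set" and w :: "'i \<Rightarrow> bool" and x :: 'i
    and K :: "nat set" and s t :: "nat \<Rightarrow> 'i \<Rightarrow> bool"
  assumes x: "x \<notin> J"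
    and disj: "disjoint_pairs K s t"
    and oriented: "\<And>k. k \<in> K \<Longrightarrow> s k \<in> subcube J w \<and> t k \<in> subcube J w \<or>
       s k \<in> subcube J (flip x w) \<and> t k \<in> subcube J (flip x w) \<or>
       s k \<in> subcube J w \<and> t k \<in> subcube J (flip x w)"
begin

text \<open>\<open>K0\<close> and \<open>K1\<close> collect the pairs inside a facet, \<open>Kc\<close> the crossing ones, and \<open>B\<close> the crossing pairs
that are blocked: the vertex across from \<open>s k\<close> belongs to another pair.\<close>

definition "F0 = subcube J w"
definition "F1 = subcube J (flip x w)"
definition "X = terminals K s t"
definition "K0 = {k \<in> K. s k \<in> F0 \<and> t k \<in> F0}"
definition "K1 = {k \<in> K. s k \<in> F1 \<and> t k \<in> F1}"
definition "Kc = {k \<in> K. s k \<in> F0 \<and> t k \<in> F1}"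
definition "B = {k \<in> Kc. flip x (s k) \<in> X \<and> flip x (s k) \<noteq> t k}"

lemma F_disjoint: "v \<in> F0 \<Longrightarrow> v \<in> F1 \<Longrightarrow> False"
  using facets_disjoint[OF x, of w] by (auto simp: F0_def F1_def)

lemma flip_F [simp]: "flip x v \<in> F1 \<longleftrightarrow> v \<in> F0" "flip x v \<in> F0 \<longleftrightarrow> v \<in> F1"
  unfolding F0_def F1_def by (rule flip_facet[OF x])+

lemma K_cases: "k \<in> K \<Longrightarrow> k \<in> K0 \<or> k \<in> K1 \<or> k \<in> Kc"
  using oriented[of k] by (auto simp: K0_def K1_def Kc_def F0_def F1_def)

lemma K_sub: "K0 \<subseteq> K" "K1 \<subseteq> K" "Kc \<subseteq> K"
  by (auto simp: K0_def K1_def Kc_def)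

lemma K_disjoint: "K0 \<inter> K1 = {}" "K0 \<inter> Kc = {}" "K1 \<inter> Kc = {}"
  using F_disjoint by (auto simp: K0_def K1_def Kc_def)

lemma Kc_proper: "Kc \<subseteq> {k \<in> K. s k \<noteq> t k}"
  using F_disjoint by (auto simp: Kc_def)

lemma finite_K [simp]: "finite K" "finite K0" "finite K1" "finite Kc"
proof -
  show "finite K" using disj by (rule disjoint_pairs_finite)
  then show "finite K0" "finite K1" "finite Kc" by (simp_all add: K0_def K1_def Kc_def)
qed

lemma sides:
  "k \<in> K0 \<Longrightarrow> s k \<in> F0" "k \<in> K0 \<Longrightarrow> t k \<in> F0"
  "k \<in> K1 \<Longrightarrow> s k \<in> F1" "k \<in> K1 \<Longrightarrow> t k \<in> F1"
  "k \<in> Kc \<Longrightarrow> s k \<in> F0" "k \<in> Kc \<Longrightarrow> t k \<in> F1"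
  by (auto simp: K0_def K1_def Kc_def)

lemma in_X: "k \<in> K \<Longrightarrow> s k \<in> X" "k \<in> K \<Longrightarrow> t k \<in> X"
  by (auto simp: X_def terminals_def)

lemmas apart = disjoint_pairsD[OF disj]

lemma same_index:
  "i \<in> K \<Longrightarrow> j \<in> K \<Longrightarrow> s i = s j \<Longrightarrow> i = j"
  "i \<in> K \<Longrightarrow> j \<in> K \<Longrightarrow> s i = t j \<Longrightarrow> i = j"
  "i \<in> K \<Longrightarrow> j \<in> K \<Longrightarrow> t i = t j \<Longrightarrow> i = j"
  using apart[of i j] by auto

lemma inj_s: "inj_on s K"
  by (rule inj_onI) (rule same_index)

lemma inj_t: "inj_on t K"
  by (rule inj_onI) (rule same_index)

lemma X_eq: "X = s ` Kc \<union> t ` Kc \<union> terminals K0 s t \<union> terminals K1 s t"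
  unfolding X_def terminals_def using K_cases K_sub by blast

lemma X_F1: "v \<in> X \<Longrightarrow> v \<in> F1 \<Longrightarrow> (\<exists>k\<in>Kc. v = t k) \<or> v \<in> terminals K1 s t"
  unfolding X_eq terminals_def using sides F_disjoint by blast

lemma X_F0: "v \<in> X \<Longrightarrow> v \<in> F0 \<Longrightarrow> (\<exists>k\<in>Kc. v = s k) \<or> v \<in> terminals K0 s t"
  unfolding X_eq terminals_def using sides F_disjoint by blast

lemma parts: "s ` Kc \<union> terminals K0 s t \<subseteq> F0" "t ` Kc \<union> terminals K1 s t \<subseteq> F1"
  using sides by (auto simp: terminals_def)

lemma crossing_apart:
  "s ` Kc \<inter> terminals K0 s t = {}" "t ` Kc \<inter> terminals K1 s t = {}"
proof -
  have "s k \<noteq> s j \<and> s k \<noteq> t j" if "k \<in> Kc" "j \<in> K0" for k j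
    using apart[of k j] K_sub K_disjoint that by blast
  then show "s ` Kc \<inter> terminals K0 s t = {}" unfolding terminals_def by blast
  have "t k \<noteq> s j \<and> t k \<noteq> t j" if "k \<in> Kc" "j \<in> K1" for k j
    using apart[of k j] K_sub K_disjoint that by blast
  then show "t ` Kc \<inter> terminals K1 s t = {}" unfolding terminals_def by blast
qed

lemma card_X:
  "card X = 2 * card Kc + card (terminals K0 s t) + card (terminals K1 s t)"
proof -
  have "X = (s ` Kc \<union> terminals K0 s t) \<union> (t ` Kc \<union> terminals K1 s t)"
    unfolding X_eq by blast
  moreover have "(s ` Kc \<union> terminals K0 s t) \<inter> (t ` Kc \<union> terminals K1 s t) = {}"
    using parts F_disjoint by blast
  ultimately have "card X = card (s ` Kc \<union> terminals K0 s t) + card (t ` Kc \<union> terminals K1 s t)"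
    using card_Un_disjoint by (metis finite_vertices)
  moreover have "card (s ` Kc \<union> terminals K0 s t) = card (s ` Kc) + card (terminals K0 s t)"
    by (intro card_Un_disjoint crossing_apart finite_vertices)
  moreover have "card (t ` Kc \<union> terminals K1 s t) = card (t ` Kc) + card (terminals K1 s t)"
    by (intro card_Un_disjoint crossing_apart finite_vertices)
  moreover have "card (s ` Kc) = card Kc"
    by (rule card_image, rule inj_on_subset[OF inj_s K_sub(3)])
  moreover have "card (t ` Kc) = card Kc"
    by (rule card_image, rule inj_on_subset[OF inj_t K_sub(3)])
  ultimately show ?thesis by linarith
qed

text \<open>Admissible places to leave the near facet: the vertices \<open>r k\<close> and their copies across may meet terminals
only in the pair's own ends.\<close>

definition detour :: "(nat \<Rightarrow> 'i \<Rightarrow> bool) \<Rightarrow> bool" where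
  "detour r \<longleftrightarrow> inj_on r Kc \<and> (\<forall>k\<in>Kc. r k \<in> F0 \<and> (r k \<in> X \<longrightarrow> r k = s k) \<and>
                                       (flip x (r k) \<in> X \<longrightarrow> flip x (r k) = t k))"

text \<open>Let \<open>d = card J\<close>.  A blocked \<open>s k\<close> has \<open>d\<close> neighbours in the near facet, so it suffices to bound the
number of those that are unusable or already chosen.  Project everything to the near facet: at most
\<open>d + 2 - card D\<close> positions \<open>Q\<close> are occupied, where \<open>D\<close> are those occupied from both sides, and every
blocked \<open>s j\<close> is in \<open>D\<close>.  By parity, neighbours of \<open>s j\<close> compete with neighbours of \<open>s k\<close> only if \<open>s j\<close> and
\<open>s k\<close> have equal colour, and then \<open>s j\<close> itself is an occupied position that is not a neighbour of
\<open>s k\<close>.  So occupied neighbours and competitors, pair \<open>k\<close> included, together number at most \<open>card Q\<close>.  This is at most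
\<open>d\<close> if \<open>card D \<ge> 2\<close>; otherwise the position of \<open>t k\<close> is occupied by \<open>t k\<close> alone, which may be used
by the pair itself, and one more position is saved.\<close>

lemma detour_exists:
  assumes "card X \<le> card J + 2"
  shows "\<exists>r. detour r \<and> (\<forall>k\<in>Kc. s k = r k \<or> adj (s k) (r k)) \<and> (\<forall>k\<in>Kc - B. r k = s k)"
proof -
  define Q where "Q = (X \<inter> F0) \<union> flip x ` (X \<inter> F1)"
  define D where "D = (X \<inter> F0) \<inter> flip x ` (X \<inter> F1)"
  define N where "N k = (\<lambda>y. flip y (s k)) ` J" for k
  define Y where "Y k = {v \<in> N k. v \<in> X \<or> flip x v \<in> X \<and> flip x v \<noteq> t k}" for k
  define S where "S k = {j \<in> B. even_vertex (s j) = even_vertex (s k)}" for k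
  have X: "X = (X \<inter> F0) \<union> (X \<inter> F1)"
    unfolding X_eq terminals_def using sides by blast
  have cX: "card X = card (X \<inter> F0) + card (X \<inter> F1)"
    by (subst X, rule card_Un_disjoint) (auto dest: F_disjoint)
  have "card (flip x ` (X \<inter> F1)) = card (X \<inter> F1)"
    by (intro card_image) (auto simp: inj_on_def)
  then have cO: "card Q + card D \<le> card J + 2"
    using card_Un_Int[of "X \<inter> F0" "flip x ` (X \<inter> F1)"] cX assms by (simp add: Q_def D_def)
  have N: "N k \<subseteq> F0" "card (N k) = card J" if "k \<in> B" for k
  proof -
    have "s k \<in> F0" using that by (auto simp: B_def sides)
    then show "N k \<subseteq> F0" by (auto simp: N_def F0_def subcube_flip)
    show "card (N k) = card J" unfolding N_def by (intro card_image) (auto simp: inj_on_def)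
  qed
  have par_N: "even_vertex v \<longleftrightarrow> \<not> even_vertex (s k)" if "v \<in> N k" for v k
    using that by (auto simp: N_def)
  have D_iff: "v \<in> D \<longleftrightarrow> v \<in> F0 \<and> v \<in> X \<and> flip x v \<in> X" for v
    unfolding D_def using flip_F by (force simp: image_iff flip_swap)
  have sD: "s k \<in> D" if "k \<in> B" for k
    using that in_X K_sub by (auto simp: D_iff B_def sides)
  have D_sub: "D \<subseteq> Q" by (auto simp: D_def Q_def)
  have Y_sub: "Y k \<subseteq> Q" if "k \<in> B" for k
  proof
    fix v assume "v \<in> Y k"
    then have "v \<in> F0" "v \<in> X \<or> flip x v \<in> X" using N(1)[OF that] by (auto simp: Y_def)
    then show "v \<in> Q" unfolding Q_def by (auto intro!: image_eqI[where x = "flip x v"])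
  qed
  have large: "card (S k) \<le> card (N k - Y k)" if k: "k \<in> B" for k
  proof -
    have dis: "Y k \<inter> s ` S k = {}"
      using par_N by (auto simp: Y_def S_def)
    have "card (s ` S k) = card (S k)"
      by (rule card_image, rule inj_on_subset[OF inj_s]) (auto simp: S_def B_def Kc_def)
    then have cU: "card (Y k \<union> s ` S k) = card (Y k) + card (S k)"
      using card_Un_disjoint[of "Y k" "s ` S k"] dis by simp
    have U: "Y k \<union> s ` S k \<subseteq> Q" using Y_sub[OF k] sD D_sub by (auto simp: S_def)
    have "card (Y k) + card (S k) \<le> card J"
    proof (cases "card D \<ge> 2")
      case True
      have "card (Y k \<union> s ` S k) \<le> card Q" using U by (intro card_mono) auto
      then show ?thesis using cU cO True by simp
    next
      case False
      have "D = {s k}"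
      proof (rule ccontr)
        assume "D \<noteq> {s k}"
        then obtain v where "v \<in> D" "v \<noteq> s k" using sD[OF k] by blast
        then have "card {v, s k} \<le> card D" using sD[OF k] by (intro card_mono) auto
        then show False using \<open>v \<noteq> s k\<close> False by simp
      qed
      define v where "v = flip x (t k)"
      have kc: "k \<in> Kc" "flip x (s k) \<noteq> t k" using k by (auto simp: B_def)
      have tk: "t k \<in> X" "v \<in> F0" using kc in_X K_sub sides by (auto simp: v_def)
      have "v \<noteq> s k" using kc by (metis flip_flip v_def)
      then have vD: "v \<notin> D" using \<open>D = {s k}\<close> by simp
      then have "v \<notin> X" using tk by (auto simp: D_iff v_def)
      then have "v \<notin> Y k" by (auto simp: Y_def v_def)
      moreover have "v \<notin> s ` S k" using vD sD by (auto simp: S_def)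
      moreover have "v \<in> Q" using tk kc sides by (auto simp: Q_def v_def)
      ultimately have "Y k \<union> s ` S k \<subset> Q" using U by blast
      then have "card (Y k \<union> s ` S k) < card Q" by (intro psubset_card_mono) auto
      then show ?thesis using cU cO \<open>D = {s k}\<close> by simp
    qed
    moreover have "card (N k - Y k) = card (N k) - card (Y k)"
      by (intro card_Diff_subset) (auto simp: Y_def)
    ultimately show ?thesis using N(2)[OF k] by simp
  qed
  have "finite B" by (rule finite_subset[of _ Kc]) (auto simp: B_def)
  then have "\<exists>f. inj_on f B \<and> (\<forall>k\<in>B. f k \<in> N k - Y k)"
  proof (rule distinct_representatives[where p = "\<lambda>k. even_vertex (s k)"])
    show "(N j - Y j) \<inter> (N k - Y k) = {}" if "even_vertex (s j) \<noteq> even_vertex (s k)" for j k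
      using par_N that by blast
    show "card {j \<in> B. even_vertex (s j) = even_vertex (s k)} \<le> card (N k - Y k)" if "k \<in> B" for k
      using large[OF that] by (simp add: S_def)
  qed
  then obtain f where f: "inj_on f B" "\<And>k. k \<in> B \<Longrightarrow> f k \<in> N k - Y k" by blast
  define r where "r k = (if k \<in> B then f k else s k)" for k
  have fX: "f k \<notin> X" if "k \<in> B" for k using f(2)[OF that] by (auto simp: Y_def)
  have "inj_on r Kc"
  proof (rule inj_onI)
    fix j k assume jk: "j \<in> Kc" "k \<in> Kc" "r j = r k"
    then show "j = k"
      using fX[of j] fX[of k] in_X(1)[of j] in_X(1)[of k] K_sub inj_onD[OF inj_s, of j k]
        inj_onD[OF f(1), of j k] by (auto simp: r_def split: if_splits)
  qed
  moreover have "r k \<in> F0 \<and> (r k \<in> X \<longrightarrow> r k = s k) \<and> (flip x (r k) \<in> X \<longrightarrow> flip x (r k) = t k)"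
    if "k \<in> Kc" for k
  proof (cases "k \<in> B")
    case True
    then show ?thesis using f(2)[OF True] N(1)[OF True] by (auto simp: r_def Y_def)
  next
    case False
    then show ?thesis using that sides by (auto simp: r_def B_def)
  qed
  moreover have "s k = r k \<or> adj (s k) (r k)" if "k \<in> Kc" for k
    using f(2)[of k] by (auto simp: r_def N_def)
  moreover have "\<forall>k\<in>Kc - B. r k = s k" by (simp add: r_def)
  ultimately show ?thesis unfolding detour_def by blast
qed

section \<open>Assembling linkages of the two facets\<close>

text \<open>The subproblems in the two facets.  In the near facet a crossing pair becomes \<open>(s k, r k)\<close>, in the far
facet \<open>(flip x (r k), t k)\<close>.  The pairs in \<open>M \<subseteq> K0\<close> are moved: they only reserve their ends in the near
facet and are linked in the far one.\<close>

definition "near_end r k = (if k \<in> Kc then r k else t k)"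
definition "far_start r M k = (if k \<in> Kc then flip x (r k) else if k \<in> M then flip x (s k) else s k)"
definition "far_end M k = (if k \<in> M then flip x (t k) else t k)"

lemma detourD:
  assumes "detour r" "k \<in> Kc"
  shows "r k \<in> F0" "r k \<in> X \<Longrightarrow> r k = s k" "flip x (r k) \<in> X \<Longrightarrow> flip x (r k) = t k"
  using assms by (auto simp: detour_def)

lemma detour_apart:
  assumes "detour r" "k \<in> Kc" "j \<in> K" "j \<noteq> k"
  shows "r k \<noteq> s j" "r k \<noteq> t j" "flip x (r k) \<noteq> s j" "flip x (r k) \<noteq> t j"
proof -
  have k: "k \<in> K" using assms K_sub by blast
  note a = apart[OF k assms(3)] detourD[OF assms(1,2)] in_X[OF assms(3)]
  show "r k \<noteq> s j" "r k \<noteq> t j" "flip x (r k) \<noteq> s j" "flip x (r k) \<noteq> t j"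
    using a assms(4) by metis+
qed

lemma detour_inj: "detour r \<Longrightarrow> i \<in> Kc \<Longrightarrow> j \<in> Kc \<Longrightarrow> i \<noteq> j \<Longrightarrow> r i \<noteq> r j"
  unfolding detour_def inj_on_def by blast

lemma near_family:
  assumes "detour r"
  shows "disjoint_pairs (K0 \<union> Kc) s (near_end r)"
    and "terminals (K0 \<union> Kc) s (near_end r) \<subseteq> subcube J w"
proof -
  show "disjoint_pairs (K0 \<union> Kc) s (near_end r)"
    unfolding disjoint_pairs_def
  proof (intro ballI impI)
    fix i j assume ij: "i \<in> K0 \<union> Kc" "j \<in> K0 \<union> Kc" "i \<noteq> j"
    then have K: "i \<in> K" "j \<in> K" using K_sub by auto
    have "s i \<noteq> s j" "s i \<noteq> t j" "t i \<noteq> s j" "t i \<noteq> t j"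
      using apart[OF K ij(3)] by auto
    moreover have "r i \<noteq> s j \<and> r i \<noteq> t j \<and> s j \<noteq> r i \<and> t j \<noteq> r i" if "i \<in> Kc"
      using detour_apart[OF assms that K(2)] ij(3) by metis
    moreover have "r j \<noteq> s i \<and> r j \<noteq> t i" if "j \<in> Kc"
      using detour_apart[OF assms that K(1)] ij(3) by simp
    moreover have "r i \<noteq> r j" if "i \<in> Kc" "j \<in> Kc"
      using detour_inj[OF assms that ij(3)] .
    ultimately show "{s i, near_end r i} \<inter> {s j, near_end r j} = {}"
      unfolding near_end_def by (cases "i \<in> Kc"; cases "j \<in> Kc") simp_all
  qed
  show "terminals (K0 \<union> Kc) s (near_end r) \<subseteq> subcube J w"
    using sides detourD(1)[OF assms] by (auto simp: near_end_def terminals_def F0_def)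
qed

lemma far_family:
  assumes r: "detour r" and M: "M \<subseteq> K0"
    and free: "\<And>k. k \<in> M \<Longrightarrow> flip x (s k) \<notin> X" "\<And>k. k \<in> M \<Longrightarrow> flip x (t k) \<notin> X"
  shows "disjoint_pairs (K1 \<union> Kc \<union> M) (far_start r M) (far_end M)"
    and "terminals (K1 \<union> Kc \<union> M) (far_start r M) (far_end M) \<subseteq> subcube J (flip x w)"
proof -
  have MK: "k \<notin> Kc" "k \<notin> K1" if "k \<in> M" for k using that M K_disjoint by auto
  show "disjoint_pairs (K1 \<union> Kc \<union> M) (far_start r M) (far_end M)"
    unfolding disjoint_pairs_def
  proof (intro ballI impI)
    fix i j assume ij: "i \<in> K1 \<union> Kc \<union> M" "j \<in> K1 \<union> Kc \<union> M" "i \<noteq> j"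
    then have K: "i \<in> K" "j \<in> K" using K_sub M by auto
    have free': "flip x (s k) \<noteq> s l" "flip x (s k) \<noteq> t l" "flip x (t k) \<noteq> s l" "flip x (t k) \<noteq> t l"
      if "k \<in> M" "l \<in> K" for k l
      using free[OF that(1)] in_X[OF that(2)] by metis+
    have cross: "flip x (r k) \<noteq> s l" "flip x (r k) \<noteq> t l" "r k \<noteq> s l" "r k \<noteq> t l"
      if "k \<in> Kc" "l \<in> K" "l \<noteq> k" for k l
      using detour_apart[OF r that] by auto
    have ends: "v = s k \<and> k \<in> K1 \<or> v = t k \<and> (k \<in> K1 \<or> k \<in> Kc) \<or> v = flip x (r k) \<and> k \<in> Kc \<or>
        v = flip x (s k) \<and> k \<in> M \<or> v = flip x (t k) \<and> k \<in> M"
      if "k \<in> K1 \<union> Kc \<union> M" "v \<in> {far_start r M k, far_end M k}" for k v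
      using that MK[of k] by (auto simp: far_start_def far_end_def split: if_splits)
    have False if "v \<in> {far_start r M i, far_end M i}" "v \<in> {far_start r M j, far_end M j}" for v
      using ends[OF ij(1) that(1)] ends[OF ij(2) that(2)]
      using apart[OF K ij(3)] free'[OF _ K(1)] free'[OF _ K(2)]
        cross[OF _ K(1) ij(3)] cross[OF _ K(2) ij(3)[symmetric]] detour_inj[OF r _ _ ij(3)]
      by (elim disjE conjE; hypsubst?; metis flip_flip)
    then show "{far_start r M i, far_end M i} \<inter> {far_start r M j, far_end M j} = {}" by blast
  qed
  show "terminals (K1 \<union> Kc \<union> M) (far_start r M) (far_end M) \<subseteq> subcube J (flip x w)"
  proof -
    have "far_start r M k \<in> F1 \<and> far_end M k \<in> F1" if km: "k \<in> K1 \<union> Kc \<union> M" for k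
    proof -
      consider "k \<in> K1" "k \<notin> Kc" "k \<notin> M" | "k \<in> Kc" "k \<notin> M" | "k \<in> M" "k \<in> K0" "k \<notin> Kc"
        using km MK[of k] M by blast
      then show ?thesis
        using sides[of k] detourD(1)[OF r, of k] by cases (simp_all add: far_start_def far_end_def)
    qed
    then show ?thesis unfolding terminals_def F1_def by blast
  qed
qed

text \<open>The paths in the two facets are joined by edges in direction \<open>x\<close>: a crossing pair uses the one at
\<open>r k\<close>, a moved pair those at both of its ends.\<close>

lemma linked_from_facets:
  assumes M: "M \<subseteq> K0" and r: "detour r"
    and C: "\<And>k. k \<in> K0 \<union> Kc \<Longrightarrow> C k \<subseteq> F0"
      "\<And>k. k \<in> K0 \<union> Kc - M \<Longrightarrow> joined (C k) (s k) (near_end r k)"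
      "\<And>k. k \<in> M \<Longrightarrow> s k \<in> C k \<and> t k \<in> C k"
      "\<And>i j. i \<in> K0 \<union> Kc \<Longrightarrow> j \<in> K0 \<union> Kc \<Longrightarrow> i \<noteq> j \<Longrightarrow> C i \<inter> C j = {}"
    and far: "linked F1 (K1 \<union> Kc \<union> M) (far_start r M) (far_end M)"
  shows "linked (subcube (insert x J) w) K s t"
proof -
  obtain D where "\<forall>k\<in>K1 \<union> Kc \<union> M. D k \<subseteq> F1 \<and> joined (D k) (far_start r M k) (far_end M k)"
    "\<forall>i\<in>K1 \<union> Kc \<union> M. \<forall>j\<in>K1 \<union> Kc \<union> M. i \<noteq> j \<longrightarrow> D i \<inter> D j = {}"
    by (rule linkedE[OF far])
  note D0 = this
  have D1: "D k \<subseteq> F1" and D2: "joined (D k) (far_start r M k) (far_end M k)" if "k \<in> K1 \<union> Kc \<union> M" for k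
    using bspec[OF D0(1) that] by simp_all
  have D3: "D i \<inter> D j = {}" if "i \<in> K1 \<union> Kc \<union> M" "j \<in> K1 \<union> Kc \<union> M" "i \<noteq> j" for i j
    using bspec[OF bspec[OF D0(2) that(1)] that(2)] that(3) by simp
  note D = D1 D2 D3
  define E where "E k = (if k \<in> K0 \<union> Kc then C k else {}) \<union> (if k \<in> K1 \<union> Kc \<union> M then D k else {})" for k
  have V: "subcube (insert x J) w = F0 \<union> F1"
    unfolding F0_def F1_def by (rule subcube_insert_split)
  have C_sub: "C k \<subseteq> E k" if "k \<in> K0 \<union> Kc" for k using that by (auto simp: E_def)
  have D_sub: "D k \<subseteq> E k" if "k \<in> K1 \<union> Kc \<union> M" for k using that by (auto simp: E_def)
  show ?thesis
  proof (rule linkedI[of _ E])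
    fix k assume k: "k \<in> K"
    show "E k \<subseteq> subcube (insert x J) w" unfolding V using C(1) D(1) by (auto simp: E_def)
    consider "k \<in> K1" | "k \<in> Kc" | "k \<in> K0 - M" | "k \<in> M" using K_cases[OF k] by blast
    then show "joined (E k) (s k) (t k)"
    proof cases
      case 1
      then have "k \<notin> Kc" "k \<notin> M" using M K_disjoint by auto
      then show ?thesis
        using 1 joined_mono[OF D(2) D_sub, of k] by (simp add: far_start_def far_end_def)
    next
      case 2
      then have nM: "k \<notin> M" using M K_disjoint by auto
      have a: "joined (E k) (s k) (r k)"
        using 2 nM joined_mono[OF C(2) C_sub, of k] by (simp add: near_end_def)
      have b: "joined (E k) (flip x (r k)) (t k)"
        using 2 nM joined_mono[OF D(2) D_sub, of k] by (simp add: far_start_def far_end_def)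
      have "joined (E k) (r k) (flip x (r k))"
        using joined_in[OF a] joined_in[OF b] by (intro joined_edge) auto
      then show ?thesis using a b joined_trans by blast
    next
      case 3
      then have "k \<notin> Kc" using K_disjoint by auto
      then show ?thesis
        using 3 joined_mono[OF C(2) C_sub, of k] by (simp add: near_end_def)
    next
      case 4
      then have nc: "k \<notin> Kc" "k \<in> K0" using K_disjoint M by auto
      have a: "joined (E k) (flip x (s k)) (flip x (t k))"
        using 4 nc joined_mono[OF D(2) D_sub, of k] by (simp add: far_start_def far_end_def)
      have st: "s k \<in> E k" "t k \<in> E k" using C(3)[OF 4] C_sub[of k] nc by auto
      have "joined (E k) (s k) (flip x (s k))" "joined (E k) (flip x (t k)) (t k)"
        using joined_in[OF a] st by (auto intro: joined_edge)
      then show ?thesis using a joined_trans by blast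
    qed
  next
    fix i j assume ij: "i \<in> K" "j \<in> K" "i \<noteq> j"
    have C': "C i \<inter> C j = {}" if "i \<in> K0 \<union> Kc" "j \<in> K0 \<union> Kc"
      using C(4)[OF that ij(3)] .
    have D': "D i \<inter> D j = {}" if "i \<in> K1 \<union> Kc \<union> M" "j \<in> K1 \<union> Kc \<union> M"
      using D(3)[OF that ij(3)] .
    have CD: "C k \<inter> D l = {}" if "k \<in> K0 \<union> Kc" "l \<in> K1 \<union> Kc \<union> M" for k l
      using C(1)[OF that(1)] D(1)[OF that(2)] F_disjoint by blast
    have E: "v \<in> C k \<and> k \<in> K0 \<union> Kc \<or> v \<in> D k \<and> k \<in> K1 \<union> Kc \<union> M" if "v \<in> E k" for v k
      using that by (simp only: E_def Un_iff split: if_split_asm) simp_all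
    have False if "v \<in> E i" "v \<in> E j" for v
      using E[OF that(1)] E[OF that(2)]
    proof (elim disjE conjE)
      assume "v \<in> C i" "i \<in> K0 \<union> Kc" "v \<in> C j" "j \<in> K0 \<union> Kc"
      then show False using C' by blast
    next
      assume "v \<in> D i" "i \<in> K1 \<union> Kc \<union> M" "v \<in> D j" "j \<in> K1 \<union> Kc \<union> M"
      then show False using D' by blast
    next
      assume "v \<in> C i" "i \<in> K0 \<union> Kc" "v \<in> D j" "j \<in> K1 \<union> Kc \<union> M"
      then show False using CD[of i j] by blast
    next
      assume "v \<in> D i" "i \<in> K1 \<union> Kc \<union> M" "v \<in> C j" "j \<in> K0 \<union> Kc"
      then show False using CD[of j i] by blast
    qed
    then show "E i \<inter> E j = {}" by blast
  qed
qed

lemma linked_from_linked_facets: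
  assumes r: "detour r"
    and near: "linked F0 (K0 \<union> Kc) s (near_end r)"
    and far: "linked F1 (K1 \<union> Kc) (far_start r {}) (far_end {})"
  shows "linked (subcube (insert x J) w) K s t"
proof -
  obtain C where "\<forall>k\<in>K0 \<union> Kc. C k \<subseteq> F0 \<and> joined (C k) (s k) (near_end r k)"
      "\<forall>i\<in>K0 \<union> Kc. \<forall>j\<in>K0 \<union> Kc. i \<noteq> j \<longrightarrow> C i \<inter> C j = {}"
    by (rule linkedE[OF near])
  note C0 = this
  have C1: "C k \<subseteq> F0" and C2: "joined (C k) (s k) (near_end r k)" if "k \<in> K0 \<union> Kc" for k
    using bspec[OF C0(1) that] by simp_all
  have C3: "C i \<inter> C j = {}" if "i \<in> K0 \<union> Kc" "j \<in> K0 \<union> Kc" "i \<noteq> j" for i j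
    using bspec[OF bspec[OF C0(2) that(1)] that(2)] that(3) by simp
  note C = C1 C2 C3
  show ?thesis
  proof (rule linked_from_facets[of "{}" r C])
    show "C i \<inter> C j = {}" if "i \<in> K0 \<union> Kc" "j \<in> K0 \<union> Kc" "i \<noteq> j" for i j
      using C(3) that .
    show "linked F1 (K1 \<union> Kc \<union> {}) (far_start r {}) (far_end {})" using far by simp
    show "joined (C k) (s k) (near_end r k)" if "k \<in> K0 \<union> Kc - {}" for k using C(2)[of k] that by simp
    show "C k \<subseteq> F0" if "k \<in> K0 \<union> Kc" for k using C(1)[OF that] .
    show "detour r" by (rule r)
    show "s k \<in> C k \<and> t k \<in> C k" if "k \<in> {}" for k using that by simp
  qed simp
qed

lemma near_terminals:
  assumes "\<And>k. k \<in> Kc - R \<Longrightarrow> r k = s k"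
  shows "terminals (K0 \<union> Kc) s (near_end r) \<subseteq> s ` Kc \<union> r ` (Kc \<inter> R) \<union> terminals K0 s t"
proof -
  have "near_end r k \<in> s ` Kc \<union> r ` (Kc \<inter> R)" if "k \<in> Kc" for k
    using assms[of k] that by (cases "k \<in> R") (auto simp: near_end_def)
  moreover have "near_end r k = t k" if "k \<in> K0" for k
    using that K_disjoint by (auto simp: near_end_def)
  ultimately show ?thesis unfolding terminals_def by (simp add: image_Un) blast
qed

lemma far_terminals:
  "terminals (K1 \<union> Kc \<union> M) (far_start r M) (far_end M) \<subseteq>
     flip x ` r ` Kc \<union> t ` Kc \<union> terminals K1 s t \<union> flip x ` terminals M s t"
proof -
  have "far_start r M k \<in> flip x ` r ` Kc \<union> t ` Kc \<union> terminals K1 s t \<union> flip x ` terminals M s t \<and>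
      far_end M k \<in> flip x ` r ` Kc \<union> t ` Kc \<union> terminals K1 s t \<union> flip x ` terminals M s t"
    if "k \<in> K1 \<union> Kc \<union> M" for k
    using that by (auto simp: far_start_def far_end_def terminals_def)
  then show ?thesis by (auto simp: terminals_def[of "K1 \<union> Kc \<union> M"])
qed

lemma card_Un_le3: "card (P \<union> Q \<union> R) \<le> card P + card Q + card R"
  by (meson add_le_mono card_Un_le le_refl order_trans)

lemma card_near:
  assumes "\<And>k. k \<in> Kc - R \<Longrightarrow> r k = s k"
  shows "card (terminals (K0 \<union> Kc) s (near_end r)) \<le> card Kc + card (Kc \<inter> R) + card (terminals K0 s t)"
proof -
  have "card (terminals (K0 \<union> Kc) s (near_end r)) \<le>
      card (s ` Kc \<union> r ` (Kc \<inter> R) \<union> terminals K0 s t)"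
    by (intro card_mono near_terminals assms) auto
  also have "\<dots> \<le> card (s ` Kc) + card (r ` (Kc \<inter> R)) + card (terminals K0 s t)"
    by (rule card_Un_le3)
  also have "\<dots> \<le> card Kc + card (Kc \<inter> R) + card (terminals K0 s t)"
    by (intro add_mono card_image_le order_refl) auto
  finally show ?thesis .
qed

lemma card_far:
  "card (terminals (K1 \<union> Kc \<union> M) (far_start r M) (far_end M)) \<le>
     card (flip x ` r ` Kc \<union> t ` Kc) + card (terminals K1 s t) + card (terminals M s t)"
proof -
  have "card (terminals (K1 \<union> Kc \<union> M) (far_start r M) (far_end M)) \<le>
      card ((flip x ` r ` Kc \<union> t ` Kc) \<union> terminals K1 s t \<union> flip x ` terminals M s t)"
    by (intro card_mono far_terminals) auto
  also have "\<dots> \<le> card (flip x ` r ` Kc \<union> t ` Kc) + card (terminals K1 s t) +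
      card (flip x ` terminals M s t)"
    by (rule card_Un_le3)
  also have "\<dots> \<le> card (flip x ` r ` Kc \<union> t ` Kc) + card (terminals K1 s t) + card (terminals M s t)"
    by (intro add_mono card_image_le order_refl) auto
  finally show ?thesis .
qed

lemma card_shifted: "card (flip x ` r ` Kc \<union> t ` Kc) \<le> 2 * card Kc"
proof -
  have "card (flip x ` r ` Kc) \<le> card Kc"
    unfolding image_image by (rule card_image_le) simp
  moreover have "card (t ` Kc) \<le> card Kc" by (rule card_image_le) simp
  ultimately show ?thesis using card_Un_le[of "flip x ` r ` Kc" "t ` Kc"] by linarith
qed

lemma far_family_unmoved:
  assumes "detour r"
  shows "disjoint_pairs (K1 \<union> Kc) (far_start r {}) (far_end {})"
    and "terminals (K1 \<union> Kc) (far_start r {}) (far_end {}) \<subseteq> subcube J (flip x w)"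
    and "card (terminals (K1 \<union> Kc) (far_start r {}) (far_end {})) \<le>
      card (flip x ` r ` Kc \<union> t ` Kc) + card (terminals K1 s t)"
proof -
  have e: "K1 \<union> Kc \<union> {} = K1 \<union> Kc" "card (terminals {} s t) = 0" by (simp_all add: terminals_def)
  show "disjoint_pairs (K1 \<union> Kc) (far_start r {}) (far_end {})"
    "terminals (K1 \<union> Kc) (far_start r {}) (far_end {}) \<subseteq> subcube J (flip x w)"
    using far_family[OF assms, of "{}"] by (simp_all add: e)
  show "card (terminals (K1 \<union> Kc) (far_start r {}) (far_end {})) \<le>
      card (flip x ` r ` Kc \<union> t ` Kc) + card (terminals K1 s t)"
    using card_far[of "{}" r] by (simp only: e add_0_right)
qed

text \<open>The subproblems are left as hypotheses, since in dimension 4 their solution is not an instance of the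
induction hypothesis.\<close>

lemma link_crossing_pairs_in_far_facet:
  assumes "card X \<le> card J + 2"
    and near: "\<And>r. \<lbrakk>\<And>k. k \<in> Kc \<Longrightarrow> s k = r k \<or> adj (s k) (r k);
        card (terminals (K0 \<union> Kc) s (near_end r)) \<le> card Kc + card B + card (terminals K0 s t);
        disjoint_pairs (K0 \<union> Kc) s (near_end r);
        terminals (K0 \<union> Kc) s (near_end r) \<subseteq> subcube J w\<rbrakk>
      \<Longrightarrow> linked (subcube J w) (K0 \<union> Kc) s (near_end r)"
    and far: "\<And>r. \<lbrakk>card (terminals (K1 \<union> Kc) (far_start r {}) (far_end {})) \<le> 2 * card Kc + card (terminals K1 s t);
        disjoint_pairs (K1 \<union> Kc) (far_start r {}) (far_end {});
        terminals (K1 \<union> Kc) (far_start r {}) (far_end {}) \<subseteq> subcube J (flip x w)\<rbrakk>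
      \<Longrightarrow> linked (subcube J (flip x w)) (K1 \<union> Kc) (far_start r {}) (far_end {})"
  shows "linked (subcube (insert x J) w) K s t"
proof -
  obtain r where r: "detour r" "\<forall>k\<in>Kc. s k = r k \<or> adj (s k) (r k)" "\<forall>k\<in>Kc - B. r k = s k"
    using detour_exists[OF assms(1)] by (elim exE conjE)
  have BK: "Kc \<inter> B = B" by (auto simp: B_def)
  show ?thesis
  proof (rule linked_from_linked_facets[OF r(1)])
    show "linked F0 (K0 \<union> Kc) s (near_end r)" unfolding F0_def
    proof (rule near)
      show "s k = r k \<or> adj (s k) (r k)" if "k \<in> Kc" for k using r(2) that by blast
      show "card (terminals (K0 \<union> Kc) s (near_end r)) \<le> card Kc + card B + card (terminals K0 s t)"
        using card_near[of B r] r(3) by (simp add: BK)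
    qed (rule near_family[OF r(1)])+
    show "linked F1 (K1 \<union> Kc) (far_start r {}) (far_end {})" unfolding F1_def
    proof (rule far)
      show "card (terminals (K1 \<union> Kc) (far_start r {}) (far_end {})) \<le>
          2 * card Kc + card (terminals K1 s t)"
        using far_family_unmoved(3)[OF r(1)] card_shifted[of r] by linarith
    qed (rule far_family_unmoved[OF r(1)])+
  qed
qed

text \<open>Taking \<open>flip x (t k1)\<close> as the exit of pair \<open>k1\<close> means linking this pair in the near facet.  Compared to
the previous lemma, the far subproblem has one terminal less, since the pair only keeps its end
\<open>t k1\<close> there.\<close>

lemma link_one_crossing_pair_in_near_facet:
  assumes "card X \<le> card J + 2" and k1: "k1 \<in> Kc"
    and free: "flip x (t k1) \<in> X \<Longrightarrow> flip x (t k1) = s k1"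
    and near: "\<And>r. \<lbrakk>\<And>k. k \<in> Kc - {k1} \<Longrightarrow> s k = r k \<or> adj (s k) (r k);
        card (terminals (K0 \<union> Kc) s (near_end r)) \<le> card Kc + card (insert k1 B) + card (terminals K0 s t);
        disjoint_pairs (K0 \<union> Kc) s (near_end r);
        terminals (K0 \<union> Kc) s (near_end r) \<subseteq> subcube J w\<rbrakk>
      \<Longrightarrow> linked (subcube J w) (K0 \<union> Kc) s (near_end r)"
    and far: "\<And>r. \<lbrakk>r k1 = flip x (t k1);
        card (terminals (K1 \<union> Kc) (far_start r {}) (far_end {})) \<le> 2 * card Kc - 1 + card (terminals K1 s t);
        disjoint_pairs (K1 \<union> Kc) (far_start r {}) (far_end {});
        terminals (K1 \<union> Kc) (far_start r {}) (far_end {}) \<subseteq> subcube J (flip x w)\<rbrakk>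
      \<Longrightarrow> linked (subcube J (flip x w)) (K1 \<union> Kc) (far_start r {}) (far_end {})"
  shows "linked (subcube (insert x J) w) K s t"
proof -
  obtain q where q: "detour q" "\<forall>k\<in>Kc. s k = q k \<or> adj (s k) (q k)" "\<forall>k\<in>Kc - B. q k = s k"
    using detour_exists[OF assms(1)] by (elim exE conjE)
  define r where "r = q(k1 := flip x (t k1))"
  have r1: "r k1 = flip x (t k1)" by (simp add: r_def)
  have kK: "k1 \<in> K" using k1 K_sub by blast
  have ne: "q k \<noteq> flip x (t k1)" if "k \<in> Kc" "k \<noteq> k1" for k
    using detour_apart(4)[OF q(1) that(1) kK] that by (metis flip_flip)
  have "inj_on r Kc"
  proof (rule inj_onI)
    fix i j assume ij: "i \<in> Kc" "j \<in> Kc" "r i = r j"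
    show "i = j"
    proof (rule ccontr)
      assume "i \<noteq> j"
      then show False
        using ij ne[of i] ne[of j] detour_inj[OF q(1), of i j]
        by (cases "i = k1"; cases "j = k1") (auto simp: r_def)
    qed
  qed
  moreover have "r k \<in> F0 \<and> (r k \<in> X \<longrightarrow> r k = s k) \<and> (flip x (r k) \<in> X \<longrightarrow> flip x (r k) = t k)"
    if "k \<in> Kc" for k
  proof (cases "k = k1")
    case True
    then show ?thesis using free sides(6)[OF k1] r1 by auto
  next
    case False
    then show ?thesis using detourD[OF q(1) that] by (auto simp: r_def)
  qed
  ultimately have r: "detour r" by (simp add: detour_def)
  have BK: "Kc \<inter> insert k1 B = insert k1 B" using k1 by (auto simp: B_def)
  show ?thesis
  proof (rule linked_from_linked_facets[OF r])
    show "linked F0 (K0 \<union> Kc) s (near_end r)" unfolding F0_def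
    proof (rule near)
      show "s k = r k \<or> adj (s k) (r k)" if "k \<in> Kc - {k1}" for k using q(2) that by (auto simp: r_def)
      show "card (terminals (K0 \<union> Kc) s (near_end r)) \<le>
          card Kc + card (insert k1 B) + card (terminals K0 s t)"
        using card_near[of "insert k1 B" r] q(3) by (simp add: BK r_def)
    qed (rule near_family[OF r])+
    have "flip x (r k) \<in> flip x ` r ` (Kc - {k1}) \<union> t ` Kc" if "k \<in> Kc" for k
      using that k1 r1 by (cases "k = k1") auto
    then have "flip x ` r ` Kc \<union> t ` Kc \<subseteq> flip x ` r ` (Kc - {k1}) \<union> t ` Kc" by auto
    then have "card (flip x ` r ` Kc \<union> t ` Kc) \<le> card (flip x ` r ` (Kc - {k1}) \<union> t ` Kc)"
      by (intro card_mono) auto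
    also have "\<dots> \<le> card (flip x ` r ` (Kc - {k1})) + card (t ` Kc)" by (rule card_Un_le)
    also have "card (flip x ` r ` (Kc - {k1})) \<le> card (Kc - {k1})"
      unfolding image_image by (rule card_image_le) simp
    also have "card (t ` Kc) \<le> card Kc" by (rule card_image_le) simp
    finally have "card (flip x ` r ` Kc \<union> t ` Kc) \<le> 2 * card Kc - 1"
      using k1 by (simp add: card_gt_0_iff)
    then have "card (terminals (K1 \<union> Kc) (far_start r {}) (far_end {})) \<le>
        2 * card Kc - 1 + card (terminals K1 s t)"
      using far_family_unmoved(3)[OF r] by linarith
    then show "linked F1 (K1 \<union> Kc) (far_start r {}) (far_end {})" unfolding F1_def
      by (intro far r1 far_family_unmoved(1,2)[OF r])
  qed
qed

end

section \<open>Induction on the dimension\<close>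

text \<open>The statement of the induction.  Reserved vertices, that is pairs with \<open>s k = t k\<close>, count as one
terminal each.\<close>

definition linkable :: "'i::finite set \<Rightarrow> bool" where
  "linkable J \<longleftrightarrow> (\<forall>w K s t. disjoint_pairs K s t \<longrightarrow> terminals K s t \<subseteq> subcube J w \<longrightarrow>
     card (terminals K s t) \<le> card J + 1 \<longrightarrow> linked (subcube J w) K s t)"

lemma linkableD:
  "linkable J \<Longrightarrow> disjoint_pairs K s t \<Longrightarrow> terminals K s t \<subseteq> subcube J w \<Longrightarrow>
    card (terminals K s t) \<le> card J + 1 \<Longrightarrow> linked (subcube J w) K s t"
  by (simp add: linkable_def)

text \<open>With one terminal too many, forget \<open>s k0\<close> and only reserve the other end \<open>t k0\<close>.  The forgotten vertex
lies on at most one of the resulting paths, say of pair \<open>k1\<close>.  Once that path is discarded, the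
remaining ones avoid the terminals of all other pairs, and the pairs \<open>k0\<close> and \<open>k1\<close> can be
linked elsewhere.\<close>

lemma link_all_but_two:
  fixes J :: "'i::finite set"
  assumes J: "linkable J" and disj: "disjoint_pairs K s t"
    and sub: "terminals K s t \<subseteq> subcube J w"
    and card: "card (terminals K s t) \<le> card J + 2" and k0: "k0 \<in> K"
  shows "\<exists>k1 C. (\<forall>k\<in>K. C k \<subseteq> subcube J w \<and> s k \<in> C k \<and> t k \<in> C k) \<and>
     (\<forall>k\<in>K - {k0, k1}. joined (C k) (s k) (t k)) \<and> (\<forall>i\<in>K. \<forall>j\<in>K. i \<noteq> j \<longrightarrow> C i \<inter> C j = {})"
proof -
  \<comment> \<open>A degenerate pair disappears altogether when its only vertex is forgotten.\<close>
  define L where "L = (if s k0 = t k0 then K - {k0} else K)"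
  define p where "p = s(k0 := t k0)"
  have L: "L \<subseteq> K" "K - {k0} \<subseteq> L" by (auto simp: L_def)
  note apart = disjoint_pairsD[OF disj]
  have "terminals L p t \<subseteq> terminals K s t - {s k0}"
  proof -
    have "p k \<noteq> s k0 \<and> t k \<noteq> s k0 \<and> p k \<in> terminals K s t \<and> t k \<in> terminals K s t" if k: "k \<in> L" for k
    proof (cases "k = k0")
      case True
      then have "s k0 \<noteq> t k0" using k by (simp add: L_def split: if_split_asm)
      then show ?thesis using True k0 by (simp add: p_def terminals_def)
    next
      case False
      have "k \<in> K" using k L by auto
      then show ?thesis using apart[OF \<open>k \<in> K\<close> k0 False] False
        by (simp add: p_def terminals_def)
    qed
    then show ?thesis by (auto simp: terminals_def[of L])
  qed
  note Lt = this
  have "card (terminals L p t) \<le> card (terminals K s t - {s k0})"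
    using Lt by (intro card_mono) auto
  also have "card (terminals K s t - {s k0}) = card (terminals K s t) - 1"
    using k0 by (intro card_Diff_singleton) (auto simp: terminals_def)
  finally have cL: "card (terminals L p t) \<le> card J + 1" using card by linarith
  have "disjoint_pairs L p t"
    unfolding disjoint_pairs_def
  proof (intro ballI impI)
    fix i j assume "i \<in> L" "j \<in> L" "i \<noteq> j"
    then have "i \<in> K" "j \<in> K" "i \<noteq> j" using L by auto
    from apart[OF this] show "{p i, t i} \<inter> {p j, t j} = {}" by (auto simp: p_def)
  qed
  moreover have "terminals L p t \<subseteq> subcube J w" using Lt sub by blast
  ultimately have "linked (subcube J w) L p t"
    using cL by (rule linkableD[OF J])
  then obtain D where D: "\<forall>k\<in>L. D k \<subseteq> subcube J w \<and> joined (D k) (p k) (t k)"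
    "\<forall>i\<in>L. \<forall>j\<in>L. i \<noteq> j \<longrightarrow> D i \<inter> D j = {}"
    by (rule linkedE)
  have D_ends: "s k \<in> D k" "t k \<in> D k" if "k \<in> K - {k0}" for k
  proof -
    have k: "k \<in> L" "k \<noteq> k0" using subsetD[OF L(2) that] that by simp_all
    have "joined (D k) (p k) (t k)" using bspec[OF D(1) k(1)] by (rule conjunct2)
    then have c: "joined (D k) (s k) (t k)" using k(2) by (simp add: p_def)
    show "s k \<in> D k" by (rule joined_in(1)[OF c])
    show "t k \<in> D k" by (rule joined_in(2)[OF c])
  qed
  obtain k1 where k1: "\<forall>k\<in>K - {k0, k1}. s k0 \<notin> D k"
  proof (cases "\<exists>k\<in>K - {k0}. s k0 \<in> D k")
    case True
    then obtain k1 where "k1 \<in> K - {k0}" "s k0 \<in> D k1" by blast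
    then have "\<forall>k\<in>K - {k0, k1}. s k0 \<notin> D k" using D(2) L by blast
    then show thesis by (rule that)
  next
    case False
    then have "\<forall>k\<in>K - {k0, k0}. s k0 \<notin> D k" by blast
    then show thesis by (rule that)
  qed
  define C where "C k = (if k = k0 \<or> k = k1 then {s k, t k} else D k)" for k
  have old: "D k \<inter> {s j, t j} = {}" if k: "k \<in> K - {k0, k1}" and j: "j \<in> K" "j = k0 \<or> j = k1" for k j
  proof (cases "j = k0")
    case True
    have "t k0 \<notin> D k"
    proof (cases "s k0 = t k0")
      case True then show ?thesis using k1 k by auto
    next
      case False
      then have "k0 \<in> L" using k0 by (simp add: L_def)
      moreover from this have "t k0 \<in> D k0" using joined_in(2)[OF conjunct2[OF bspec[OF D(1)]]] by simp
      ultimately show ?thesis using D(2) k L by blast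
    qed
    then show ?thesis using True k1 k by auto
  next
    case False
    then have "j \<in> K - {k0}" "j \<noteq> k" using j k by auto
    then have "{s j, t j} \<subseteq> D j" "D k \<inter> D j = {}" using D_ends[of j] D(2) L k by auto
    then show ?thesis by blast
  qed
  have "\<forall>k\<in>K. C k \<subseteq> subcube J w \<and> s k \<in> C k \<and> t k \<in> C k"
  proof
    fix k assume k: "k \<in> K"
    have "s k \<in> subcube J w" "t k \<in> subcube J w" using k sub by (auto simp: terminals_def)
    moreover have "D k \<subseteq> subcube J w" if "k \<noteq> k0"
    proof -
      have "k \<in> L" using k that L by blast
      then show ?thesis using D(1) by simp
    qed
    ultimately show "C k \<subseteq> subcube J w \<and> s k \<in> C k \<and> t k \<in> C k"
      using D_ends[of k] k by (simp add: C_def)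
  qed
  moreover have "\<forall>k\<in>K - {k0, k1}. joined (C k) (s k) (t k)"
  proof
    fix k assume k: "k \<in> K - {k0, k1}"
    then have "k \<in> L" using L by blast
    then show "joined (C k) (s k) (t k)" using bspec[OF D(1), of k] k by (simp add: C_def p_def)
  qed
  moreover have "\<forall>i\<in>K. \<forall>j\<in>K. i \<noteq> j \<longrightarrow> C i \<inter> C j = {}"
  proof (intro ballI impI)
    fix i j assume ij: "i \<in> K" "j \<in> K" "i \<noteq> j"
    have "D i \<inter> D j = {}" if "i \<notin> {k0, k1}" "j \<notin> {k0, k1}"
      using D(2) L ij that by blast
    moreover have "{s i, t i} \<inter> {s j, t j} = {}" using apart[OF ij] by blast
    moreover have "{s i, t i} \<inter> D j = {}" if "i \<in> {k0, k1}" "j \<notin> {k0, k1}"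
      using old[of j i] that ij by (simp add: Int_commute)
    moreover note old[of i j] ij
    ultimately show "C i \<inter> C j = {}"
      unfolding C_def by (cases "i = k0 \<or> i = k1"; cases "j = k0 \<or> j = k1") simp_all
  qed
  ultimately show ?thesis by (intro exI[of _ k1] exI[of _ C] conjI)
qed

text \<open>Double counting of the edges between terminals.  The graph being bipartite, there are at most
\<open>(card X)\<^sup>2 / 4\<close> of them, with \<open>card X \<le> n + 1\<close> for \<open>n = card I\<close>.  If every one of the \<open>n\<close> directions
contained at least \<open>(n - 1) / 2\<close>, then \<open>2 * n * (n - 1) \<le> (n + 1)\<^sup>2\<close>, which fails from \<open>n = 5\<close> on.\<close>

lemma sparse_direction:
  fixes I :: "'i::finite set"
  assumes "card I \<ge> 5" "card X \<le> card I + 1"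
  shows "\<exists>x\<in>I. 2 * card {v \<in> X. even_vertex v \<and> flip x v \<in> X} + 1 < card I"
proof (rule ccontr)
  assume dense: "\<not> ?thesis"
  define e where "e x = card {v \<in> X. even_vertex v \<and> flip x v \<in> X}" for x
  define P where "P = {v \<in> X. even_vertex v}"
  define S where "S = (SIGMA x:I. {v \<in> X. even_vertex v \<and> flip x v \<in> X})"
  have "card ((\<lambda>(x, v). (v, flip x v)) ` S) \<le> card (P \<times> (X - P))"
    by (rule card_mono) (auto simp: S_def P_def)
  moreover have "inj_on (\<lambda>(x, v). (v, flip x v)) S"
    by (auto simp: inj_on_def)
  ultimately have "card S \<le> card P * card (X - P)"
    by (simp add: card_image card_cartesian_product)
  moreover have "card S = (\<Sum>x\<in>I. e x)" unfolding S_def e_def by (rule card_SigmaI) auto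
  ultimately have sum: "(\<Sum>x\<in>I. e x) \<le> card P * card (X - P)" by simp
  have "(\<Sum>x\<in>I. card I) \<le> (\<Sum>x\<in>I. 2 * e x + 1)"
    using dense by (intro sum_mono) (auto simp: e_def not_less)
  also have "\<dots> = 2 * (\<Sum>x\<in>I. e x) + card I"
    by (simp add: sum.distrib sum_distrib_left sum_Suc)
  finally have 1: "card I * card I \<le> 2 * (\<Sum>x\<in>I. e x) + card I" by simp
  have PX: "card P + card (X - P) = card X"
    using card_Diff_subset[of P X] card_mono[of X P] by (auto simp: P_def)
  define n a b where "n = int (card I)" and "a = int (card P)" and "b = int (card (X - P))"
  have "n * n \<le> 2 * (a * b) + n"
  proof -
    have "card I * card I \<le> 2 * (card P * card (X - P)) + card I" using 1 sum by linarith
    then have "int (card I * card I) \<le> int (2 * (card P * card (X - P)) + card I)"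
      by (simp only: of_nat_le_iff)
    then show ?thesis by (simp add: n_def a_def b_def)
  qed
  moreover have "4 * (a * b) \<le> (a + b) * (a + b)"
  proof -
    have "0 \<le> (a - b) * (a - b)" by simp
    then show ?thesis by (simp add: algebra_simps)
  qed
  moreover have "(a + b) * (a + b) \<le> (n + 1) * (n + 1)"
    using PX assms(2) by (intro mult_mono) (auto simp: n_def a_def b_def)
  moreover have "5 * n \<le> n * n" using assms(1) by (intro mult_right_mono) (auto simp: n_def)
  ultimately have "n \<le> 1" by (simp add: algebra_simps)
  then show False using assms(1) by (simp add: n_def)
qed

context facet_split begin

text \<open>A blocked pair yields an edge between terminals in direction \<open>x\<close>, which is counted at its even
end.\<close>

lemma card_B: "card B \<le> card {v \<in> X. even_vertex v \<and> flip x v \<in> X}"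
proof (rule card_inj_on_le[where f = "\<lambda>k. if even_vertex (s k) then s k else flip x (s k)"])
  have B: "k \<in> K" "s k \<in> F0" "s k \<in> X" "flip x (s k) \<in> X" if "k \<in> B" for k
    using that K_sub in_X(1)[of k] by (auto simp: B_def sides)
  show "inj_on (\<lambda>k. if even_vertex (s k) then s k else flip x (s k)) B"
  proof (rule inj_onI)
    fix i j assume ij: "i \<in> B" "j \<in> B"
      "(if even_vertex (s i) then s i else flip x (s i)) = (if even_vertex (s j) then s j else flip x (s j))"
    have "s i \<noteq> flip x (s j)" "flip x (s i) \<noteq> s j"
      using B(2)[OF ij(1)] B(2)[OF ij(2)] F_disjoint flip_F by metis+
    then have "s i = s j" using ij(3) by (auto split: if_splits)
    then show "i = j" using same_index(1) B(1) ij by blast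
  qed
  show "(\<lambda>k. if even_vertex (s k) then s k else flip x (s k)) ` B \<subseteq> {v \<in> X. even_vertex v \<and> flip x v \<in> X}"
    using B by auto
qed simp

lemma B_sub: "B \<subseteq> Kc" by (auto simp: B_def)

text \<open>Moving the crossing pairs to the far facet saves the terminals of \<open>K0\<close> there, so the far
subproblem is within its bound.  So is the near one unless all crossing pairs are blocked and
\<open>K1\<close> is empty.  In that case the far facet contains nothing but the copies of the
\<open>s k\<close>; hence the pairs of \<open>K0\<close> can be moved there, and sparsity leaves room for as many of them as
\<open>link_all_but_two\<close> leaves unlinked.  If there are crossing pairs, \<open>k0\<close> is chosen
among them: its ends \<open>s k0\<close> and \<open>r k0\<close> are adjacent anyway, so only \<open>k1\<close> may need to be moved.\<close>

lemma link_with_near_pair: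
  assumes J: "linkable J" "card J \<ge> 4" and cX: "card X \<le> card J + 2"
    and sparse: "2 * card B < card J" and K0: "K0 \<noteq> {}"
  shows "linked (subcube (insert x J) w) K s t"
proof -
  define a b c where "a = card (terminals K0 s t)" and "b = card (terminals K1 s t)" and "c = card Kc"
  have a: "a \<ge> 1" using K0 by (auto simp: a_def terminals_def card_gt_0_iff Suc_le_eq)
  have X: "card X = 2 * c + a + b" using card_X by (simp add: a_def b_def c_def)
  have Bc: "card B \<le> c" unfolding c_def by (intro card_mono B_sub) simp
  show ?thesis
  proof (cases "card B < c \<or> b \<ge> 1")
    case True
    then have le: "card Kc + card B + card (terminals K0 s t) \<le> card J + 1"
      "2 * card Kc + card (terminals K1 s t) \<le> card J + 1"
      using X cX a Bc by (auto simp: a_def b_def c_def)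
    show ?thesis
    proof (rule link_crossing_pairs_in_far_facet[OF cX], goal_cases)
      case (1 r)
      then show ?case using le(1) by (intro linkableD[OF J(1)]; linarith?)
    next
      case (2 r)
      then show ?case using le(2) by (intro linkableD[OF J(1)]; linarith?)
    qed
  next
    case False
    have "B = Kc" using False Bc B_sub by (intro card_subset_eq) (auto simp: c_def)
    have "terminals K1 s t = {}" using False by (simp add: b_def not_less_eq_eq)
    then have K1: "K1 = {}" by (simp add: terminals_def)
    obtain r where r: "detour r" "\<forall>k\<in>Kc. s k = r k \<or> adj (s k) (r k)" "\<forall>k\<in>Kc - B. r k = s k"
      using detour_exists[OF cX] by (elim exE conjE)
    have near: "card (terminals (K0 \<union> Kc) s (near_end r)) \<le> card J + 2"
      using card_near[of Kc r] X cX by (simp add: a_def c_def)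
    obtain k0 where k0: "k0 \<in> K0 \<union> Kc" "Kc \<noteq> {} \<Longrightarrow> k0 \<in> Kc" using K0 by blast
    obtain k1 C where C: "\<forall>k\<in>K0 \<union> Kc. C k \<subseteq> subcube J w \<and> s k \<in> C k \<and> near_end r k \<in> C k"
      "\<forall>k\<in>K0 \<union> Kc - {k0, k1}. joined (C k) (s k) (near_end r k)"
      "\<forall>i\<in>K0 \<union> Kc. \<forall>j\<in>K0 \<union> Kc. i \<noteq> j \<longrightarrow> C i \<inter> C j = {}"
      using link_all_but_two[OF J(1) near_family[OF r(1)] near k0(1)] by (elim exE conjE)
    \<comment> \<open>The unlinked pairs that do not cross are moved to the far facet.\<close>
    define M where "M = {k0, k1} \<inter> K0"
    have M: "M \<subseteq> K0" by (simp add: M_def)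
    \<comment> \<open>All pairs being blocked, the far facet contains just the copies of the near ends of crossing pairs.\<close>
    have "flip x ` s ` Kc = t ` Kc"
    proof (rule card_subset_eq)
      show "flip x ` s ` Kc \<subseteq> t ` Kc"
      proof clarify
        fix k assume "k \<in> Kc"
        then have "flip x (s k) \<in> X" "flip x (s k) \<in> F1" using \<open>B = Kc\<close> sides by (auto simp: B_def)
        then show "flip x (s k) \<in> t ` Kc" using X_F1[of "flip x (s k)"] K1 by (auto simp: terminals_def)
      qed
      have "inj_on (flip x \<circ> s) Kc"
        using inj_on_subset[OF inj_s K_sub(3)] by (auto simp: inj_on_def)
      then have "card (flip x ` s ` Kc) = card Kc" by (metis card_image image_comp)
      moreover have "card (t ` Kc) = card Kc"
        by (rule card_image, rule inj_on_subset[OF inj_t K_sub(3)])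
      ultimately show "card (flip x ` s ` Kc) = card (t ` Kc)" by simp
    qed simp
    then have free: "flip x v \<notin> X" if "v \<in> terminals K0 s t" for v
    proof -
      have v: "v \<in> F0" using that parts by blast
      have "v \<notin> s ` Kc" using that crossing_apart by blast
      then have "flip x v \<notin> t ` Kc"
        unfolding \<open>flip x ` s ` Kc = t ` Kc\<close>[symmetric] by auto
      then show ?thesis using X_F1[of "flip x v"] v K1 by (auto simp: terminals_def)
    qed
    show ?thesis
    proof (rule linked_from_facets[of M r C])
      show "joined (C k) (s k) (near_end r k)" if k: "k \<in> K0 \<union> Kc - M" for k
      proof (cases "k \<in> {k0, k1}")
        case False then show ?thesis using C(2) k by blast
      next
        case True
        then have kc: "k \<in> Kc" using k by (auto simp: M_def)
        then have "near_end r k = r k" by (simp add: near_end_def)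
        moreover have "s k \<in> C k" "near_end r k \<in> C k" using bspec[OF C(1), of k] kc by simp_all
        moreover have "s k = r k \<or> adj (s k) (r k)" using r(2) kc by blast
        ultimately show ?thesis using joined_step[of "s k" "near_end r k" "C k"] by simp
      qed
      show "s k \<in> C k \<and> t k \<in> C k" if "k \<in> M" for k
      proof -
        have "k \<in> K0" using that M by blast
        moreover from this have "near_end r k = t k" using K_disjoint by (auto simp: near_end_def)
        ultimately show ?thesis using C(1) by force
      qed
      show "C k \<subseteq> F0" if "k \<in> K0 \<union> Kc" for k using C(1) that by (auto simp: F0_def)
      show "C i \<inter> C j = {}" if "i \<in> K0 \<union> Kc" "j \<in> K0 \<union> Kc" "i \<noteq> j" for i j
        using C(3) that by blast
      have fr: "flip x (s k) \<notin> X" "flip x (t k) \<notin> X" if "k \<in> M" for k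
      proof -
        have "s k \<in> terminals K0 s t" "t k \<in> terminals K0 s t"
          using that M by (auto simp: terminals_def)
        then show "flip x (s k) \<notin> X" "flip x (t k) \<notin> X" using free by auto
      qed
      have cM: "card (terminals M s t) \<le> 2 * card M"
      proof -
        have "card (terminals M s t) \<le> card (s ` M) + card (t ` M)"
          unfolding terminals_def by (rule card_Un_le)
        moreover have "finite M" by (simp add: M_def)
        ultimately show ?thesis using card_image_le[of M s] card_image_le[of M t] by linarith
      qed
      have "2 * c + card (terminals M s t) \<le> card J + 1"
      proof (cases "Kc = {}")
        case True
        have "card M \<le> card {k0, k1}" by (intro card_mono) (auto simp: M_def)
        also have "\<dots> \<le> 2" by (simp add: card_insert_if)
        finally show ?thesis using cM True J(2) by (simp add: c_def)
      next
        case False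
        then have "k0 \<notin> K0" using k0(2) K_disjoint by auto
        then have "card M \<le> card {k1}" by (intro card_mono) (auto simp: M_def)
        then show ?thesis using cM sparse \<open>B = Kc\<close> by (simp add: c_def)
      qed
      then have "card (terminals (K1 \<union> Kc \<union> M) (far_start r M) (far_end M)) \<le> card J + 1"
        using card_far[of M r] card_shifted[of r] False by (simp add: b_def c_def)
      then show "linked F1 (K1 \<union> Kc \<union> M) (far_start r M) (far_end M)"
        unfolding F1_def using far_family[OF r(1) M fr] by (intro linkableD[OF J(1)])
    qed (use M r in simp_all)
  qed
qed

text \<open>With \<open>card J + 2\<close> terminals the far facet would receive one too many, so one pair is linked in the
near facet.  Its end \<open>t k1\<close> must not be blocked; sparsity ensures that such a pair exists and that
the near facet has room for it.\<close>

lemma link_all_crossing: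
  assumes J: "linkable J" "card J \<ge> 4" and cX: "card X \<le> card J + 2"
    and sparse: "2 * card B < card J" and cross: "K0 = {}" "K1 = {}"
  shows "linked (subcube (insert x J) w) K s t"
proof -
  have X: "card X = 2 * card Kc" using card_X cross by (simp add: terminals_def)
  have t0: "card (terminals K0 s t) = 0" "card (terminals K1 s t) = 0"
    using cross by (simp_all add: terminals_def)
  have Bc: "card B \<le> card Kc" by (intro card_mono B_sub) simp
  show ?thesis
  proof (cases "card X \<le> card J + 1")
    case True
    then have le: "card Kc + card B + card (terminals K0 s t) \<le> card J + 1"
      "2 * card Kc + card (terminals K1 s t) \<le> card J + 1"
      using X Bc t0 by auto
    show ?thesis
    proof (rule link_crossing_pairs_in_far_facet[OF cX], goal_cases)
      case (1 r)
      then show ?case using le(1) by (intro linkableD[OF J(1)]; linarith?)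
    next
      case (2 r)
      then show ?case using le(2) by (intro linkableD[OF J(1)]; linarith?)
    qed
  next
    case False
    then have cKc: "2 * card Kc = card J + 2" using X cX by simp
    \<comment> \<open>If every far end were blocked, the vertices across would all be blocked near ends, against sparsity.\<close>
    have "\<exists>k1\<in>Kc. flip x (t k1) \<in> X \<longrightarrow> flip x (t k1) = s k1"
    proof (rule ccontr)
      assume neg: "\<not> ?thesis"
      have "flip x ` t ` Kc \<subseteq> s ` B"
      proof clarify
        fix k assume k: "k \<in> Kc"
        then have ft: "flip x (t k) \<in> X" "flip x (t k) \<noteq> s k" using neg by blast+
        moreover have "flip x (t k) \<in> F0" using sides(6)[OF k] by simp
        ultimately obtain j where j: "j \<in> Kc" "flip x (t k) = s j"
          using X_F0[of "flip x (t k)"] cross by (auto simp: terminals_def)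
        have sj: "flip x (s j) = t k" using j(2) by (metis flip_flip)
        have "j \<noteq> k" using j ft by auto
        moreover have "j \<in> K" "k \<in> K" using j k K_sub by auto
        ultimately have "flip x (s j) \<in> X" "flip x (s j) \<noteq> t j"
          unfolding sj using in_X(2)[of k] apart[of j k] by auto
        then have "j \<in> B" using j by (simp add: B_def)
        then show "flip x (t k) \<in> s ` B" using j by simp
      qed
      then have "card (flip x ` t ` Kc) \<le> card (s ` B)" by (intro card_mono) auto
      also have "\<dots> \<le> card B" by (rule card_image_le) (rule finite_subset[OF B_sub], simp)
      finally have "card (flip x ` t ` Kc) \<le> card B" .
      moreover have "card (flip x ` t ` Kc) = card Kc"
      proof -
        have "inj_on (flip x \<circ> t) Kc"
          using inj_on_subset[OF inj_t K_sub(3)] by (auto simp: inj_on_def)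
        then show ?thesis by (metis card_image image_comp)
      qed
      ultimately show False using sparse cKc by linarith
    qed
    then obtain k1 where k1: "k1 \<in> Kc" "flip x (t k1) \<in> X \<Longrightarrow> flip x (t k1) = s k1" by blast
    have "card (insert k1 B) \<le> card B + 1"
      by (simp add: card_insert_if finite_subset[OF B_sub])
    then have le: "card Kc + card (insert k1 B) + card (terminals K0 s t) \<le> card J + 1"
      "2 * card Kc - 1 + card (terminals K1 s t) \<le> card J + 1"
      using cKc sparse t0 by linarith+
    show ?thesis
    proof (rule link_one_crossing_pair_in_near_facet[OF cX k1], goal_cases)
      case (2 r)
      then show ?case using le(1) by (intro linkableD[OF J(1)]; linarith?)
    next
      case (3 r)
      then show ?case using le(2) by (intro linkableD[OF J(1)]; linarith?)
    qed
  qed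
qed

end

text \<open>Swapping the ends of a pair is harmless, so the orientation required by \<open>facet_split\<close> can be assumed.\<close>

lemma obtain_orientation:
  fixes J :: "'i::finite set"
  assumes x: "x \<notin> J" and disj: "disjoint_pairs K s t"
    and sub: "terminals K s t \<subseteq> subcube (insert x J) w"
  obtains p q where "facet_split J w x K p q" "terminals K p q = terminals K s t"
    "\<forall>k\<in>K. p k = s k \<and> q k = t k \<or> p k = t k \<and> q k = s k"
proof -
  define p where "p k = (if s k \<in> subcube J w then s k else t k)" for k
  define q where "q k = (if s k \<in> subcube J w then t k else s k)" for k
  have pq: "p k = s k \<and> q k = t k \<or> p k = t k \<and> q k = s k" for k
    by (simp add: p_def q_def)
  have set: "{p k, q k} = {s k, t k}" for k using pq[of k] by auto
  have terms: "terminals K p q = terminals K s t"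
  proof -
    have "terminals K s t = (\<Union>k\<in>K. {s k, t k})" for s t :: "nat \<Rightarrow> 'i \<Rightarrow> bool"
      by (auto simp: terminals_def)
    then show ?thesis by (simp only: set)
  qed
  have "facet_split J w x K p q"
  proof
    show "x \<notin> J" by (rule x)
    show "disjoint_pairs K p q" using disj by (simp only: disjoint_pairs_def set)
    fix k assume "k \<in> K"
    then have "s k \<in> subcube (insert x J) w" "t k \<in> subcube (insert x J) w"
      using sub by (auto simp: terminals_def)
    then show "p k \<in> subcube J w \<and> q k \<in> subcube J w \<or>
       p k \<in> subcube J (flip x w) \<and> q k \<in> subcube J (flip x w) \<or>
       p k \<in> subcube J w \<and> q k \<in> subcube J (flip x w)"
      unfolding subcube_insert_split p_def q_def by auto
  qed
  moreover have "\<forall>k\<in>K. p k = s k \<and> q k = t k \<or> p k = t k \<and> q k = s k"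
    using pq by blast
  ultimately show thesis using terms by (intro that[of p q])
qed

text \<open>If some pair stays within a facet in the chosen direction, that facet is taken as the near one;
otherwise all pairs cross.\<close>

lemma linkable_step:
  fixes I :: "'i::finite set"
  assumes IH: "\<And>J :: 'i set. card J + 1 = card I \<Longrightarrow> linkable J" and dim: "card I \<ge> 5"
  shows "linkable I"
  unfolding linkable_def
proof (intro allI impI)
  fix w K s t
  assume disj: "disjoint_pairs K s t" and sub: "terminals K s t \<subseteq> subcube I w"
    and card: "card (terminals K s t) \<le> card I + 1"
  obtain x where dir: "x \<in> I"
    "2 * card {v \<in> terminals K s t. even_vertex v \<and> flip x v \<in> terminals K s t} + 1 < card I"
    using sparse_direction[OF dim card] by blast
  define J where "J = I - {x}"
  have I: "I = insert x J" "x \<notin> J" using dir by (auto simp: J_def)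
  have cJ: "card J + 1 = card I" using I by simp
  have J: "linkable J" "card J \<ge> 4" using IH cJ dim by auto
  have base: "subcube (insert x J) u = subcube I w" if "u \<in> subcube I w" for u
    using subcube_eq[OF that] I by simp
  show "linked (subcube I w) K s t"
  proof (cases "\<exists>k\<in>K. s k x = t k x")
    case True
    then obtain k where k: "k \<in> K" "s k x = t k x" by blast
    have st: "s k \<in> subcube I w" "t k \<in> subcube I w" using k sub by (auto simp: terminals_def)
    obtain p q where pq: "facet_split J (s k) x K p q" "terminals K p q = terminals K s t"
      "\<forall>k\<in>K. p k = s k \<and> q k = t k \<or> p k = t k \<and> q k = s k"
      using obtain_orientation[OF I(2) disj sub[folded base[OF st(1)]]] .
    interpret facet_split J "s k" x K p q by (rule pq(1))
    have "t k \<in> subcube J (s k)"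
      using facet_iff(1)[OF I(2), of "t k" "s k"] st(2) k(2) unfolding base[OF st(1)] by simp
    then have "k \<in> K0" using k(1) pq(3) by (auto simp: K0_def F0_def)
    moreover have "2 * card B < card J" using card_B dir(2) cJ pq(2) unfolding X_def by simp
    moreover have "card X \<le> card J + 2" using card cJ by (simp add: X_def pq(2))
    ultimately have "linked (subcube (insert x J) (s k)) K p q"
      using J by (intro link_with_near_pair) auto
    then have "linked (subcube I w) K p q" by (simp only: base[OF st(1)])
    then show ?thesis using pq(3) by (rule linked_reorient)
  next
    case False
    obtain p q where pq: "facet_split J w x K p q" "terminals K p q = terminals K s t"
      "\<forall>k\<in>K. p k = s k \<and> q k = t k \<or> p k = t k \<and> q k = s k"
      using obtain_orientation[OF I(2) disj sub[unfolded I(1)]] .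
    interpret facet_split J w x K p q by (rule pq(1))
    have "p k x \<noteq> q k x" if "k \<in> K" for k
      using False bspec[OF pq(3) that] that by auto
    moreover have "v x = w x" if "v \<in> F0" for v using that I(2) by (simp add: F0_def subcube_def)
    moreover have "v x \<longleftrightarrow> \<not> w x" if "v \<in> F1" for v using that I(2) by (simp add: F1_def subcube_def)
    ultimately have no: "\<not> (p k \<in> F0 \<and> q k \<in> F0)" "\<not> (p k \<in> F1 \<and> q k \<in> F1)" if "k \<in> K" for k
      using that by metis+
    then have "K0 = {}" "K1 = {}" unfolding K0_def K1_def by blast+
    moreover have "2 * card B < card J" using card_B dir(2) cJ pq(2) unfolding X_def by simp
    moreover have "card X \<le> card J + 2" using card cJ by (simp add: X_def pq(2))
    ultimately have "linked (subcube (insert x J) w) K p q"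
      using J by (intro link_all_crossing) auto
    then have "linked (subcube I w) K p q" by (simp only: I(1)[symmetric])
    then show ?thesis using pq(3) by (rule linked_reorient)
  qed
qed

section \<open>Dimension four\<close>

text \<open>Antipodes within a face with set of directions \<open>D\<close>.\<close>

definition other_ends :: "'i set \<Rightarrow> ('i \<Rightarrow> bool) \<Rightarrow> 'i \<Rightarrow> bool" where
  "other_ends D v = (\<lambda>i. if i \<in> D then \<not> v i else v i)"

text \<open>A direction that keeps pair \<open>k2\<close> in one facet and does not keep pair \<open>k1\<close> in the same one leaves one
proper pair to be linked in each of the two 3-cubes.\<close>

lemma linkable_4_separated:
  fixes I :: "'i::finite set"
  assumes dim: "card I = 4" and disj: "disjoint_pairs K s t"
    and sub: "terminals K s t \<subseteq> subcube I w" and card: "card (terminals K s t) \<le> 5"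
    and two: "k1 \<in> K" "k2 \<in> K" "k1 \<noteq> k2" "\<And>k. k \<in> K - {k1, k2} \<Longrightarrow> s k = t k"
    and dir: "x \<in> I" "s k2 x = t k2 x" "s k1 x = t k1 x \<Longrightarrow> s k1 x \<noteq> s k2 x"
    and ne: "s k2 \<noteq> t k2"
  shows "linked (subcube I w) K s t"
proof -
  define J where "J = I - {x}"
  have I: "I = insert x J" "x \<notin> J" using dir by (auto simp: J_def)
  have cJ: "card J = 3" using I dim by simp
  have st: "s k \<in> subcube I w" "t k \<in> subcube I w" if "k \<in> K" for k
    using that sub by (auto simp: terminals_def)
  have base: "subcube (insert x J) (s k2) = subcube I w"
    using subcube_eq[OF st(1)[OF two(2)]] I by simp
  obtain p q where pq: "facet_split J (s k2) x K p q" "terminals K p q = terminals K s t"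
    "\<forall>k\<in>K. p k = s k \<and> q k = t k \<or> p k = t k \<and> q k = s k"
    using obtain_orientation[OF I(2) disj sub[folded base]] .
  interpret facet_split J "s k2" x K p q by (rule pq(1))
  have side: "v \<in> F0 \<longleftrightarrow> v x = s k2 x" if "v \<in> subcube I w" for v
    using facet_iff(1)[OF I(2), of v "s k2"] that unfolding base F0_def by simp
  have k2: "k2 \<in> K0"
    using pq(3) two(2) side st[OF two(2)] dir(2) by (auto simp: K0_def)
  have k1: "k1 \<notin> K0"
    using pq(3) two(1) side st[OF two(1)] dir(3) by (auto simp: K0_def)
  have Kc: "Kc \<subseteq> {k1}"
  proof
    fix k assume k: "k \<in> Kc"
    have "k \<in> K" "k \<noteq> k2" using k k2 K_sub K_disjoint by auto
    moreover have "s k \<noteq> t k" using k Kc_proper pq(3) K_sub by fastforce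
    ultimately show "k \<in> {k1}" using two(4)[of k] by auto
  qed
  have easy: "p k = q k" if "k \<in> K - {k1, k2}" for k
    using two(4)[OF that] pq(3) that by auto
  define a b c where "a = card (terminals K0 p q)" and "b = card (terminals K1 p q)" and "c = card Kc"
  have X: "2 * c + a + b \<le> 5" using card_X card pq(2) by (simp add: X_def a_def b_def c_def)
  have pq2: "p k2 \<noteq> q k2" using ne pq(3) two(2) by auto
  have a: "a \<ge> 2"
  proof -
    have "card {p k2, q k2} \<le> a" unfolding a_def
      using k2 by (intro card_mono) (auto simp: terminals_def)
    then show ?thesis using pq2 by simp
  qed
  have cB: "card B \<le> c" "c \<le> 1"
    unfolding c_def using card_mono[OF _ Kc] by (auto intro!: card_mono B_sub)
  have bB: "c + card B + a \<le> 4"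
  proof (cases "B = {}")
    case True
    have False if "b = 0" "c = 0"
    proof -
      have "terminals K1 p q = {}" "Kc = {}" using that by (auto simp: b_def c_def)
      then show False using K_cases[OF two(1)] k1 by (auto simp: terminals_def)
    qed
    then have "b \<noteq> 0 \<or> c \<noteq> 0" by blast
    then show ?thesis using True X cB(2) by auto
  next
    case False
    then obtain k where k: "k \<in> B" by blast
    then have kc: "k \<in> Kc" "flip x (p k) \<in> X" "flip x (p k) \<noteq> q k" by (auto simp: B_def)
    have "k = k1" using Kc kc by auto
    have "flip x (p k) \<in> terminals K1 p q"
      using X_F1[OF kc(2)] sides(5)[OF kc(1)] kc(3) Kc \<open>k = k1\<close> by auto
    then have "b \<ge> 1" by (auto simp: b_def card_gt_0_iff Suc_le_eq)
    moreover have "c \<ge> 1" using kc(1) by (auto simp: c_def card_gt_0_iff Suc_le_eq)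
    ultimately show ?thesis using X cB by linarith
  qed
  have "linked (subcube (insert x J) (s k2)) K p q"
  proof (rule link_crossing_pairs_in_far_facet, goal_cases)
    case 1
    then show ?case using card pq(2) cJ by (simp add: X_def)
  next
    case (2 r)
    have "p k = near_end r k \<or> adj (p k) (near_end r k)" if "k \<in> K0 \<union> Kc - {k2}" for k
    proof (cases "k \<in> Kc")
      case True then show ?thesis using 2(1) by (simp add: near_end_def)
    next
      case False
      then have "k \<in> K - {k1, k2}" using that k1 K_sub by auto
      then show ?thesis using easy False by (simp add: near_end_def)
    qed
    then show ?case
      using 2 bB cJ by (intro linked_if_one_proper_pair[where h = k2]) (auto simp: a_def c_def)
  next
    case (3 r)
    have "far_start r {} k = far_end {} k \<or> adj (far_start r {} k) (far_end {} k)"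
      if "k \<in> K1 \<union> Kc - {k1}" for k
    proof -
      have "k \<in> K - {k1, k2}" "k \<notin> Kc" using that Kc k2 K_sub K_disjoint by auto
      then show ?thesis using easy by (simp add: far_start_def far_end_def)
    qed
    then show ?case
      using 3 X a cJ by (intro linked_if_one_proper_pair[where h = k1]) (auto simp: b_def c_def)
  qed
  then have "linked (subcube I w) K p q" by (simp only: base)
  then show ?thesis using pq(3) by (rule linked_reorient)
qed

lemma other_ends_simps [simp]:
  "other_ends D (other_ends D v) = v"
  "other_ends D (flip x v) = flip x (other_ends D v)"
proof -
  show "other_ends D (other_ends D v) = v" by (rule ext) (simp add: other_ends_def)
  show "other_ends D (flip x v) = flip x (other_ends D v)"
    by (rule ext) (simp add: other_ends_def flip_def)
qed

text \<open>Each pair consists of antipodes of a face with directions \<open>D\<close>.  Splitting in a direction of \<open>D\<close> makes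
both cross.  Pair \<open>k1\<close> is linked in the near facet and pair \<open>k2\<close> in the far one; the reserved vertex, if any,
is arranged to be on the far side, where there is one terminal to spare.\<close>

lemma linkable_4_parallel:
  fixes I :: "'i::finite set"
  assumes dim: "card I = 4" and disj: "disjoint_pairs K s t"
    and sub: "terminals K s t \<subseteq> subcube I w" and card: "card (terminals K s t) \<le> 5"
    and rest: "card (terminals (K - {k1, k2}) s t) \<le> 1"
    and two: "k1 \<in> K" "k2 \<in> K" "k1 \<noteq> k2" "\<And>k. k \<in> K - {k1, k2} \<Longrightarrow> s k = t k"
    and ends: "t k1 = other_ends D (s k1)" "t k2 = other_ends D (s k2)"
    and dir: "x \<in> I" "x \<in> D" "flip x (t k1) \<notin> {s k2, t k2}"
  shows "linked (subcube I w) K s t"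
proof -
  define J where "J = I - {x}"
  have I: "I = insert x J" "x \<notin> J" using dir by (auto simp: J_def)
  have cJ: "card J = 3" using I dim by simp
  define E where "E = terminals (K - {k1, k2}) s t"
  have cE: "card E \<le> 1" "E \<subseteq> subcube I w"
    using rest sub by (auto simp: E_def terminals_def)
  \<comment> \<open>The near facet is the one through \<open>u\<close>, chosen to miss the reserved vertex.\<close>
  obtain u where u: "u \<in> subcube I w" "\<forall>e\<in>E. e x \<noteq> u x"
  proof (cases "E = {}")
    case True
    have "s k1 \<in> subcube I w" using sub two by (auto simp: terminals_def)
    then show thesis using True by (intro that[of "s k1"]) auto
  next
    case False
    then have "card E = 1" using cE(1) by (simp add: le_Suc_eq)
    then obtain e where "E = {e}" by (rule card_1_singletonE)
    moreover have "flip x e \<in> subcube I w" using cE(2) \<open>E = {e}\<close> dir(1) by (simp add: subcube_flip)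
    ultimately show thesis by (intro that[of "flip x e"]) auto
  qed
  have base: "subcube (insert x J) u = subcube I w" using subcube_eq[OF u(1)] I by simp
  obtain p q where pq: "facet_split J u x K p q" "terminals K p q = terminals K s t"
    "\<forall>k\<in>K. p k = s k \<and> q k = t k \<or> p k = t k \<and> q k = s k"
    using obtain_orientation[OF I(2) disj sub[folded base]] .
  interpret facet_split J u x K p q by (rule pq(1))
  have side: "v \<in> F0 \<longleftrightarrow> v x = u x" if "v \<in> subcube I w" for v
    using facet_iff(1)[OF I(2), of v u] that unfolding base F0_def by simp
  have easy: "p k = q k" "p k \<in> E" if "k \<in> K - {k1, k2}" for k
    using two(4)[OF that] bspec[OF pq(3), of k] that by (auto simp: E_def terminals_def)
  have in_cube: "p k \<in> subcube I w" "q k \<in> subcube I w" if "k \<in> K" for k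
  proof -
    have "p k \<in> terminals K p q" "q k \<in> terminals K p q" using that by (simp_all add: terminals_def)
    from this[THEN subsetD[OF sub[folded pq(2)]]] show "p k \<in> subcube I w" "q k \<in> subcube I w" .
  qed
  have cross: "k \<in> Kc" if "k = k1 \<or> k = k2" for k
  proof -
    have k: "k \<in> K" using that two by auto
    have "other_ends D v x \<noteq> v x" for v using dir(2) by (simp add: other_ends_def)
    then have "s k x \<noteq> t k x" using that ends by metis
    then have "p k x \<noteq> q k x" using bspec[OF pq(3) k] by metis
    then have "(p k \<in> F0) \<noteq> (q k \<in> F0)"
      using side[OF in_cube(1)[OF k]] side[OF in_cube(2)[OF k]] by metis
    then have "k \<notin> K0" "k \<notin> K1"
      using F_disjoint[of "p k"] F_disjoint[of "q k"] unfolding K0_def K1_def mem_Collect_eq by metis+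
    then show ?thesis using K_cases[OF k] by metis
  qed
  have others: "k \<in> K1" if "k \<in> K - {k1, k2}" for k
  proof -
    have k: "k \<in> K" using that by simp
    have "p k x \<noteq> u x" using easy(2)[OF that] u(2) by metis
    then have "p k \<notin> F0" using side[OF in_cube(1)[OF k]] by simp
    then have "k \<notin> K0" "k \<notin> Kc" by (simp_all add: K0_def Kc_def)
    then show ?thesis using K_cases[OF k] by metis
  qed
  have type: "k \<in> Kc \<longleftrightarrow> k = k1 \<or> k = k2" "k \<notin> K0" if "k \<in> K" for k
    using cross[of k] others[of k] that K_disjoint by auto
  have Kc: "Kc = {k1, k2}" using type(1) two(1,2) K_sub(3) by auto
  have K0: "K0 = {}" using type(2) K_sub(1) by auto
  \<comment> \<open>The two pairs are the only ones that cross, and the near facet contains nothing else.\<close>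
  have cKc: "card Kc = 2" using Kc two(3) by simp
  have X: "card (terminals K1 p q) \<le> 1"
    using card_X card pq(2) cKc by (simp add: X_def)
  have t0: "card (terminals K0 p q) = 0" by (simp add: K0 terminals_def)
  have "flip x (q k1) \<noteq> p k2"
  proof -
    have "flip x (t k1) \<noteq> s k2" "flip x (t k1) \<noteq> t k2" using dir(3) by auto
    moreover from this have "flip x (s k1) \<noteq> t k2" "flip x (s k1) \<noteq> s k2"
      using ends by (metis other_ends_simps)+
    ultimately show ?thesis using bspec[OF pq(3) two(1)] bspec[OF pq(3) two(2)] by metis
  qed
  then have free: "flip x (q k1) = p k1" if occ: "flip x (q k1) \<in> X"
  proof -
    have "flip x (q k1) \<in> F0" using cross[of k1] sides(6) by simp
    then obtain k where "k \<in> Kc" "flip x (q k1) = p k"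
      using X_F0[OF occ] K0 by (auto simp: terminals_def)
    then show ?thesis using \<open>flip x (q k1) \<noteq> p k2\<close> Kc by auto
  qed
  have "linked (subcube (insert x J) u) K p q"
  proof (rule link_one_crossing_pair_in_near_facet[where ?k1.0 = k1], goal_cases)
    case 1
    then show ?case using card pq(2) cJ by (simp add: X_def)
  next
    case 2 show ?case using cross by blast
  next
    case 3 then show ?case by (rule free)
  next
    case (4 r)
    have "card (insert k1 B) \<le> 2"
      using card_mono[of Kc "insert k1 B"] B_sub cross[of k1] cKc by simp
    moreover have "p k = near_end r k \<or> adj (p k) (near_end r k)" if "k \<in> K0 \<union> Kc - {k1}" for k
      using 4(1)[of k] that K0 by (simp add: near_end_def)
    ultimately show ?case
      using 4(2,3,4) t0 cJ cKc by (intro linked_if_one_proper_pair[where h = k1]) auto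
  next
    case (5 r)
    have "far_start r {} k = far_end {} k \<or> adj (far_start r {} k) (far_end {} k)"
      if "k \<in> K1 \<union> Kc - {k2}" for k
    proof (cases "k = k1")
      case True
      then show ?thesis using 5(1) cross by (simp add: far_start_def far_end_def)
    next
      case False
      then have "k \<in> K - {k1, k2}" "k \<notin> Kc" using that Kc K_sub by auto
      then show ?thesis using easy(1) by (simp add: far_start_def far_end_def)
    qed
    then show ?case
      using 5(2,3,4) X cJ cKc by (intro linked_if_one_proper_pair[where h = k2]) auto
  qed
  then have "linked (subcube I w) K p q" by (simp only: base)
  then show ?thesis using pq(3) by (rule linked_reorient)
qed

text \<open>All proper terminals lie in one facet and all reserved vertices in the other: pair \<open>k2\<close> stays, pair
\<open>k1\<close> takes the parallel route through the other facet.\<close>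

lemma linked_by_moving_one_pair:
  fixes J :: "'i::finite set"
  assumes disj: "disjoint_pairs K s t" and dim: "z \<notin> J" "card J \<ge> 3"
    and two: "k1 \<in> K" "k2 \<in> K" "k1 \<noteq> k2" "\<And>k. k \<in> K - {k1, k2} \<Longrightarrow> s k = t k"
    and inF: "{s k1, t k1, s k2, t k2} \<subseteq> subcube J u"
    and rest: "terminals (K - {k1, k2}) s t \<subseteq> subcube J (flip z u)"
      "card (terminals (K - {k1, k2}) s t) < card J"
    and free: "flip z (s k1) \<notin> terminals (K - {k1, k2}) s t"
      "flip z (t k1) \<notin> terminals (K - {k1, k2}) s t"
  shows "linked (subcube (insert z J) u) K s t"
proof -
  define E where "E = terminals (K - {k1, k2}) s t"
  define F G where "F = subcube J u" and "G = subcube J (flip z u)"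
  have FG: "subcube (insert z J) u = F \<union> G" "F \<inter> G = {}"
    unfolding F_def G_def by (rule subcube_insert_split, rule facets_disjoint[OF dim(1)])
  have F: "s k1 \<in> F" "t k1 \<in> F" "s k2 \<in> F" "t k2 \<in> F" using inF by (auto simp: F_def)
  have G: "flip z (s k1) \<in> G - E" "flip z (t k1) \<in> G - E"
    using F free flip_facet(1)[OF dim(1)] by (auto simp: F_def G_def E_def)
  have two_ends: "card {s k1, t k1} \<le> 2" by (simp add: card_insert_if)
  have near: "joined (F - {s k1, t k1}) (s k2) (t k2)" unfolding F_def
  proof (rule subcube_connected)
    have "s k2 \<noteq> s k1" "s k2 \<noteq> t k1" "t k2 \<noteq> s k1" "t k2 \<noteq> t k1"
      using disjoint_pairsD[OF disj two(2,1)] two(3) by auto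
    then show "s k2 \<notin> {s k1, t k1}" "t k2 \<notin> {s k1, t k1}" by auto
    show "card {s k1, t k1} < card J \<or> s k2 = t k2"
      using two_ends dim(2) by linarith
  qed (use F in \<open>simp_all add: F_def\<close>)
  have far: "joined (G - E) (flip z (s k1)) (flip z (t k1))" unfolding G_def
  proof (rule subcube_connected)
    show "card E < card J \<or> flip z (s k1) = flip z (t k1)" using rest(2) by (simp add: E_def)
  qed (use G in \<open>simp_all add: G_def\<close>)
  define C where "C k = (if k = k1 then {s k1, t k1} \<union> (G - E)
      else if k = k2 then F - {s k1, t k1} else {s k})" for k
  have single: "s k \<in> E" if "k \<in> K - {k1, k2}" for k using that by (auto simp: E_def terminals_def)
  have EG: "E \<subseteq> G" using rest(1) by (simp add: E_def G_def)
  show ?thesis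
  proof (rule linkedI[of _ C])
    fix k assume k: "k \<in> K"
    show "C k \<subseteq> subcube (insert z J) u"
      unfolding FG(1) using F single[of k] EG k by (auto simp: C_def)
    consider "k = k1" | "k = k2" | "k \<in> K - {k1, k2}" using k by blast
    then show "joined (C k) (s k) (t k)"
    proof cases
      case 1
      have Ck: "C k = {s k1, t k1} \<union> (G - E)" using 1 by (simp add: C_def)
      have "joined (C k) (s k1) (flip z (s k1))" "joined (C k) (flip z (t k1)) (t k1)"
        unfolding Ck using G by (intro joined_edge adj_flip UnI1 UnI2 insertI1 insertI2; simp)+
      moreover have "joined (C k) (flip z (s k1)) (flip z (t k1))"
        unfolding Ck by (rule joined_mono[OF far Un_upper2])
      ultimately have "joined (C k) (s k1) (t k1)" by (blast intro: joined_trans)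
      then show ?thesis using 1 by simp
    next
      case 2 then show ?thesis using near two(3) by (simp add: C_def)
    next
      case 3 then show ?thesis using two(4)[OF 3] by (auto simp: C_def intro: joined_refl)
    qed
  next
    fix i j assume ij: "i \<in> K" "j \<in> K" "i \<noteq> j"
    have *: "C i \<inter> C j = {}" if ij: "i \<in> K" "j \<in> K" "i \<noteq> j" "i = k1 \<or> i = k2 \<and> j \<noteq> k1" for i j
    proof (cases "i = k1")
      case True
      show ?thesis
      proof (cases "j = k2")
        case True
        then show ?thesis using \<open>i = k1\<close> two(3) FG(2) by (auto simp: C_def)
      next
        case False
        then have "s j \<in> E" using ij \<open>i = k1\<close> by (intro single) auto
        moreover have "s j \<notin> F" using \<open>s j \<in> E\<close> EG FG(2) by blast
        ultimately show ?thesis using \<open>i = k1\<close> False ij F by (auto simp: C_def)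
      qed
    next
      case False
      then have "s j \<in> E" using ij by (intro single) auto
      then have "s j \<notin> F" using EG FG(2) by blast
      then show ?thesis using False ij two(3) by (auto simp: C_def)
    qed
    show "C i \<inter> C j = {}"
    proof (cases "i \<in> {k1, k2} \<or> j \<in> {k1, k2}")
      case True
      then show ?thesis using *[of i j] *[of j i] ij by (auto simp: Int_commute)
    next
      case False
      then show ?thesis using disjoint_pairsD[OF disj ij] by (auto simp: C_def)
    qed
  qed
qed

text \<open>The obstruction from dimension 3: two pairs alternating around a square.  Two directions
\<open>z\<close> are transversal to the square, and a reserved vertex agreeing with the square in both would be one
of its corners.  So some \<open>z\<close> puts the reserved vertex into the facet opposite to the square, and the
pair to be moved there is one whose shifted ends avoid that vertex.\<close>

lemma linkable_4_square:
  fixes I :: "'i::finite set"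
  assumes dim: "card I = 4" and disj: "disjoint_pairs K s t"
    and sub: "terminals K s t \<subseteq> subcube I w"
    and rest: "card (terminals (K - {k1, k2}) s t) \<le> 1"
    and two: "k1 \<in> K" "k2 \<in> K" "k1 \<noteq> k2" "\<And>k. k \<in> K - {k1, k2} \<Longrightarrow> s k = t k"
    and xy: "x \<in> I" "y \<in> I" "x \<noteq> y" "s k1 = flip y (flip x (t k1))"
      "{s k2, t k2} = {flip x (t k1), flip y (t k1)}"
  shows "linked (subcube I w) K s t"
proof -
  define E where "E = terminals (K - {k1, k2}) s t"
  have in_cube: "s k \<in> subcube I w" "t k \<in> subcube I w" if "k \<in> K" for k
    using that sub by (auto simp: terminals_def)
  have E_sub: "E \<subseteq> subcube I w" using sub by (auto simp: E_def terminals_def)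
  have E_apart: "e \<notin> {s k1, t k1, s k2, t k2}" if e: "e \<in> E" for e
  proof -
    obtain k where "k \<in> K - {k1, k2}" "e = s k \<or> e = t k" using e by (auto simp: E_def terminals_def)
    then show ?thesis
      using disjoint_pairsD[OF disj, of k k1] disjoint_pairsD[OF disj, of k k2] two by auto
  qed
  have cI: "card (I - {x, y}) = 2" using xy dim by (simp add: card_Diff_subset)
  have "\<exists>z\<in>I - {x, y}. \<forall>e\<in>E. e z \<noteq> t k1 z"
  proof (cases "E = {}")
    case True
    have "I - {x, y} \<noteq> {}" using cI by force
    then show ?thesis using True by blast
  next
    case False
    then have "card E = 1" using rest by (simp add: E_def le_Suc_eq)
    then obtain e where e: "E = {e}" by (rule card_1_singletonE)
    show ?thesis
    proof (rule ccontr)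
      assume "\<not> ?thesis"
      then have agree: "e z = t k1 z" if "z \<in> I" "z \<noteq> x" "z \<noteq> y" for z using e that by auto
      have out: "e z = t k1 z" if "z \<notin> I" for z
        using E_sub e in_cube(2)[OF two(1)] that by (auto simp: subcube_def)
      have "e = t k1 \<or> e = flip x (t k1) \<or> e = flip y (t k1) \<or> e = flip y (flip x (t k1))"
      proof -
        have same: "e = v" if "e x = v x" "e y = v y" "\<And>z. z \<noteq> x \<Longrightarrow> z \<noteq> y \<Longrightarrow> v z = t k1 z" for v
        proof
          fix z show "e z = v z" using agree[of z] out[of z] that by (metis (full_types))
        qed
        show ?thesis
          using same[of "t k1"] same[of "flip x (t k1)"] same[of "flip y (t k1)"]
            same[of "flip y (flip x (t k1))"] xy(3) by (simp add: flip_def) (metis (full_types))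
      qed
      then show False using E_apart[of e] e xy(4,5) by auto
    qed
  qed
  then obtain z where z: "z \<in> I" "z \<noteq> x" "z \<noteq> y" "\<forall>e\<in>E. e z \<noteq> t k1 z" by blast
  define J where "J = I - {z}"
  have I: "I = insert z J" "z \<notin> J" using z by (auto simp: J_def)
  have cJ: "card J = 3" using I dim by simp
  have base: "subcube (insert z J) (t k1) = subcube I w"
    using subcube_eq[OF in_cube(2)[OF two(1)]] I by simp
  have in_F: "v \<in> subcube J (t k1)" if "v \<in> subcube I w" "v z = t k1 z" for v
    using facet_iff(1)[OF I(2), of v "t k1"] that unfolding base by simp
  have "s k1 z = t k1 z" using xy(4) z by simp
  moreover have "s k2 z = t k1 z" "t k2 z = t k1 z"
  proof -
    have v: "v z = t k1 z" if v: "v \<in> {s k2, t k2}" for v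
    proof -
      have "v = flip x (t k1) \<or> v = flip y (t k1)" using v unfolding xy(5) by simp
      then show ?thesis using z(2,3) by (elim disjE) simp_all
    qed
    show "s k2 z = t k1 z" by (rule v) simp
    show "t k2 z = t k1 z" by (rule v) simp
  qed
  ultimately have inF: "{s k1, t k1, s k2, t k2} \<subseteq> subcube J (t k1)"
    using in_F in_cube two(1,2) by auto
  have E_G: "E \<subseteq> subcube J (flip z (t k1))"
    using facet_iff(2)[OF I(2), of _ "t k1"] E_sub z(4) unfolding base by blast
  have small: "card E < card J" using rest cJ by (simp add: E_def)
  have E1: "e = e'" if "e \<in> E" "e' \<in> E" for e e'
    using rest that card_le_Suc0_iff_eq[of E] by (auto simp: E_def)
  have "linked (subcube (insert z J) (t k1)) K s t"
  proof (cases "flip z (s k1) \<in> E \<or> flip z (t k1) \<in> E")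
    case False
    then show ?thesis
      using two inF E_G small cJ unfolding E_def
      by (intro linked_by_moving_one_pair[OF disj I(2), where ?k1.0 = k1 and ?k2.0 = k2]) auto
  next
    case True
    have "{s k1, t k1} \<inter> {s k2, t k2} = {}" using disjoint_pairsD[OF disj two(1,2,3)] by blast
    then have "flip z (s k2) \<notin> E" "flip z (t k2) \<notin> E"
      using True E1 by (metis flip_inject disjoint_iff insertI1 insertI2)+
    moreover have "K - {k1, k2} = K - {k2, k1}" by blast
    ultimately show ?thesis
      using two inF E_G small cJ unfolding E_def
      by (intro linked_by_moving_one_pair[OF disj I(2), where ?k1.0 = k2 and ?k2.0 = k1]) auto
  qed
  then show ?thesis by (simp only: base)
qed

text \<open>With at most 5 terminals there are two proper pairs and at most one reserved vertex, or at most one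
proper pair.  Either some direction separates the pairs as in \<open>linkable_4_separated\<close>, or every
direction is crossed by both pairs or sees all four ends on one side.  In the latter case both pairs
are antipodes of one face, with directions \<open>D\<close>; the remaining two lemmas apply
according to whether some direction in \<open>D\<close> does not take \<open>t k1\<close> to the other pair.\<close>

lemma linkable_4:
  fixes I :: "'i::finite set"
  assumes dim: "card I = 4"
  shows "linkable I"
  unfolding linkable_def
proof (intro allI impI)
  fix w K s t
  assume disj: "disjoint_pairs K s t" and sub: "terminals K s t \<subseteq> subcube I w"
    and card: "card (terminals K s t) \<le> card I + 1"
  then have card5: "card (terminals K s t) \<le> 5" using dim by simp
  define P where "P = {k \<in> K. s k \<noteq> t k}"
  have in_cube: "s k \<in> subcube I w" "t k \<in> subcube I w" if "k \<in> K" for k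
    using that sub by (auto simp: terminals_def)
  note apart = disjoint_pairsD[OF disj]
  show "linked (subcube I w) K s t"
  proof (cases "\<exists>h. P \<subseteq> {h}")
    case True
    then obtain h where h: "P \<subseteq> {h}" by blast
    show ?thesis
    proof (rule linked_if_one_proper_pair[OF disj sub card, where h = h])
      show "s k = t k \<or> adj (s k) (t k)" if "k \<in> K - {h}" for k
        using h that by (auto simp: P_def)
    qed
  next
    case False
    then have "P \<noteq> {}" by blast
    then obtain k1 where k1: "k1 \<in> P" by blast
    have "\<not> P \<subseteq> {k1}" using False by blast
    then obtain k2 where k2: "k2 \<in> P" "k2 \<noteq> k1" by blast
    have K: "k1 \<in> K" "k2 \<in> K" "k1 \<noteq> k2" "s k1 \<noteq> t k1" "s k2 \<noteq> t k2"
      using k1 k2 by (simp_all add: P_def)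
    define Q where "Q = {s k1, t k1, s k2, t k2}"
    define E where "E = terminals (K - {k1, k2}) s t"
    have cQ: "card Q = 4" using K apart[OF K(1,2,3)] by (simp add: Q_def)
    have "terminals K s t = Q \<union> E" unfolding Q_def E_def terminals_def using K by blast
    moreover have "Q \<inter> E = {}"
    proof -
      have "v \<notin> Q" if "v = s k \<or> v = t k" "k \<in> K - {k1, k2}" for v k
        using that apart[of k k1] apart[of k k2] K by (auto simp: Q_def)
      then show ?thesis by (auto simp: E_def terminals_def)
    qed
    ultimately have "card Q + card E \<le> 5"
      using card_Un_disjoint[of Q E] card5 by simp
    then have rest: "card (terminals (K - {k1, k2}) s t) \<le> 1" using cQ by (simp add: E_def)
    have single: "s k = t k" if "k \<in> K - {k1, k2}" for k
    proof (rule ccontr)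
      assume "s k \<noteq> t k"
      moreover have "card {s k, t k} \<le> card E"
        using that by (intro card_mono) (auto simp: E_def terminals_def)
      ultimately show False using rest by (simp add: E_def)
    qed
    have swap: "K - {k2, k1} = K - {k1, k2}" by blast
    consider (A) x where "x \<in> I" "s k2 x = t k2 x" "s k1 x = t k1 x \<longrightarrow> s k1 x \<noteq> s k2 x"
      | (B) x where "x \<in> I" "s k1 x = t k1 x" "s k2 x = t k2 x \<longrightarrow> s k2 x \<noteq> s k1 x"
      | (C) "\<forall>x\<in>I. (s k1 x = t k1 x \<longleftrightarrow> s k2 x = t k2 x) \<and> (s k1 x = t k1 x \<longrightarrow> s k1 x = s k2 x)"
      by metis
    then show ?thesis
    proof cases
      case A
      show ?thesis
        by (rule linkable_4_separated[OF dim disj sub card5 K(1,2,3) single A(1,2)]) (use A K in auto)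
    next
      case B
      show ?thesis
        by (rule linkable_4_separated[OF dim disj sub card5 K(2,1) K(3)[symmetric] single[folded swap] B(1,2)])
          (use B K in auto)
    next
      case C
      define D where "D = {x \<in> I. s k1 x \<noteq> t k1 x}"
      have outside: "s k i = w i" "t k i = w i" if "i \<notin> I" "k \<in> K" for i k
        using in_cube[OF that(2)] that(1) by (simp_all add: subcube_def)
      have ends: "t k1 = other_ends D (s k1)" "t k2 = other_ends D (s k2)"
      proof -
        have D2: "i \<in> D \<longleftrightarrow> s k2 i \<noteq> t k2 i" if "i \<in> I" for i
          using bspec[OF C that] that unfolding D_def mem_Collect_eq by metis
        have D_sub: "i \<in> I" if "i \<in> D" for i using that by (simp add: D_def)
        show "t k1 = other_ends D (s k1)"
        proof
          fix i
          have "i \<in> D \<longleftrightarrow> s k1 i \<noteq> t k1 i" if "i \<in> I" using that by (simp add: D_def)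
          then show "t k1 i = other_ends D (s k1) i"
            using outside[OF _ K(1), of i] D_sub[of i] unfolding other_ends_def by metis
        qed
        show "t k2 = other_ends D (s k2)"
        proof
          fix i show "t k2 i = other_ends D (s k2) i"
            using outside[OF _ K(2), of i] D2[of i] D_sub[of i] unfolding other_ends_def by metis
        qed
      qed
      then have ends': "s k1 = other_ends D (t k1)" "s k2 = other_ends D (t k2)" by simp_all
      show ?thesis
      proof (cases "\<exists>x\<in>D. flip x (t k1) \<notin> {s k2, t k2}")
        case True
        then obtain x where x: "x \<in> D" "flip x (t k1) \<notin> {s k2, t k2}" by blast
        then have "x \<in> I" by (simp add: D_def)
        then show ?thesis
          using linkable_4_parallel[OF dim disj sub card5 rest K(1,2,3) single ends] x by blast
      next
        case False
        have "D \<noteq> {}" using ends K(4) by (auto simp: other_ends_def)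
        then obtain x where x: "x \<in> D" by blast
        have "s k1 = flip x (t k1)" if "D = {x}"
          unfolding ends'(1) that by (rule ext) (simp add: other_ends_def flip_def)
        moreover have fx: "flip x (t k1) = s k2 \<or> flip x (t k1) = t k2" using False x by blast
        ultimately have "D \<noteq> {x}" using apart[OF K(1,2,3)] by metis
        then obtain y where y: "y \<in> D" "x \<noteq> y" using x by blast
        have fy: "flip y (t k1) = s k2 \<or> flip y (t k1) = t k2" using False y by blast
        have "flip x (t k1) \<noteq> flip y (t k1)" using y by simp
        \<comment> \<open>The ends of the other pair are the neighbours of \<open>t k1\<close> in directions \<open>x\<close> and \<open>y\<close>: a square.\<close>
        then have mates: "flip x (t k1) = s k2 \<and> flip y (t k1) = t k2 \<or>
            flip x (t k1) = t k2 \<and> flip y (t k1) = s k2"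
          using fx fy by metis
        then have "other_ends D (flip y (t k1)) = flip x (t k1)" using ends ends' by metis
        then have "flip y (s k1) = flip x (t k1)" using ends' by simp
        then have "s k1 = flip y (flip x (t k1))" by (metis flip_flip)
        moreover have "{s k2, t k2} = {flip x (t k1), flip y (t k1)}" using mates by auto
        moreover have "x \<in> I" "y \<in> I" using x y by (simp_all add: D_def)
        ultimately show ?thesis
          using y(2) by (intro linkable_4_square[OF dim disj sub rest K(1,2,3) single])
      qed
    qed
  qed
qed

section \<open>All dimensions except three\<close>

theorem linkable_subcube:
  fixes I :: "'i::finite set"
  assumes "card I \<noteq> 3"
  shows "linkable I"
  using assms
proof (induction "card I" arbitrary: I rule: less_induct)
  case less
  consider "card I \<le> 2" | "card I = 4" | "card I \<ge> 5" using less.prems by linarith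
  then show ?case
  proof cases
    case 1
    show ?thesis unfolding linkable_def
    proof (intro allI impI)
      fix w K s t
      assume disj: "disjoint_pairs K s t" and sub: "terminals K s t \<subseteq> subcube I w"
        and card: "card (terminals K s t) \<le> card I + 1"
      have one: "i = j" if "i \<in> K" "j \<in> K" "s i \<noteq> t i" "s j \<noteq> t j" for i j
      proof (rule ccontr)
        assume "i \<noteq> j"
        then have "card {s i, t i, s j, t j} = 4"
          using disjoint_pairsD[OF disj that(1,2)] that by simp
        moreover have "card {s i, t i, s j, t j} \<le> card (terminals K s t)"
          using that by (intro card_mono) (auto simp: terminals_def)
        ultimately show False using card 1 by simp
      qed
      define h where "h = (SOME k. k \<in> K \<and> s k \<noteq> t k)"
      show "linked (subcube I w) K s t"
      proof (rule linked_if_one_proper_pair[OF disj sub card, where h = h])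
        fix k assume k: "k \<in> K - {h}"
        show "s k = t k \<or> adj (s k) (t k)"
        proof (rule ccontr)
          assume "\<not> ?thesis"
          then have "k \<in> K \<and> s k \<noteq> t k" using k by simp
          moreover from this have "h \<in> K \<and> s h \<noteq> t h" unfolding h_def by (rule someI)
          ultimately show False using one[of k h] k by simp
        qed
      qed
    qed
  next
    case 2
    then show ?thesis by (rule linkable_4)
  next
    case 3
    show ?thesis
    proof (rule linkable_step)
      show "linkable J" if "card J + 1 = card I" for J :: "'i set"
        using less.hyps[of J] that 3 by simp
    qed (rule 3)
  qed
qed

section \<open>The face lattice of the cube\<close>

definition cube_vertex :: "('n \<Rightarrow> bool) \<Rightarrow> real ^ 'n" where
  "cube_vertex b = (\<chi> i. if b i then 1 else - 1)"

text \<open>The geometric counterpart of \<open>subcube\<close>.\<close>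

definition cube_face :: "'n set \<Rightarrow> ('n::finite \<Rightarrow> bool) \<Rightarrow> (real ^ 'n) set" where
  "cube_face J w = {x \<in> cube_polytope. \<forall>i. i \<notin> J \<longrightarrow> x $ i = cube_vertex w $ i}"

lemma cube_vertex_inject [simp]: "cube_vertex b = cube_vertex c \<longleftrightarrow> b = c"
proof
  assume e: "cube_vertex b = cube_vertex c"
  show "b = c"
  proof
    fix i
    have "cube_vertex b $ i = cube_vertex c $ i" using e by simp
    then show "b i = c i" by (simp add: cube_vertex_def split: if_split_asm)
  qed
qed simp

lemma range_cube_vertex: "{x. \<forall>i. x $ i \<in> {-1, 1}} = range cube_vertex"
proof (intro set_eqI iffI)
  fix x :: "real ^ 'a" assume "x \<in> {x. \<forall>i. x $ i \<in> {-1, 1}}"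
  then have "x = cube_vertex (\<lambda>i. x $ i = 1)"
    unfolding cube_vertex_def vec_eq_iff by auto
  then show "x \<in> range cube_vertex" by blast
qed (auto simp: cube_vertex_def)

lemma cube_vertex_in_cube: "cube_vertex b \<in> cube_polytope"
  unfolding cube_polytope_def range_cube_vertex by (intro hull_inc rangeI)

lemma cube_coordinate_bound:
  fixes x :: "real ^ 'a::finite"
  assumes "x \<in> cube_polytope"
  shows "\<bar>x $ i\<bar> \<le> 1"
proof -
  have "(cube_polytope :: (real ^ 'a) set) \<subseteq> cbox (\<chi> i. - (1 :: real)) (\<chi> i. (1 :: real))"
    unfolding cube_polytope_def
  proof (rule hull_minimal)
    have "- 1 \<le> v $ i \<and> v $ i \<le> 1" if "\<forall>i. v $ i \<in> {-1, 1 :: real}" for v :: "real ^ 'a" and i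
      using spec[OF that, of i] by auto
    then show "{x :: real ^ 'a. \<forall>i. x $ i \<in> {-1, 1}} \<subseteq> cbox (\<chi> i. - 1) (\<chi> i. 1)"
      by (simp add: subset_iff mem_box_cart)
  qed simp
  then have "x \<in> cbox (\<chi> i. - (1 :: real)) (\<chi> i. (1 :: real))" using assms by blast
  then show ?thesis unfolding mem_box_cart by (simp add: abs_le_iff minus_le_iff)
qed

text \<open>On a cube vertex each coordinate \<open>c = \<plusminus>1\<close> is extreme among the values that \<open>cube_coordinate_bound\<close>
permits.  So if a point strictly between \<open>a\<close> and \<open>b\<close> has coordinate \<open>c\<close>, then so have \<open>a\<close> and \<open>b\<close>.\<close>

lemma cube_face_face_of: "cube_face J w face_of cube_polytope"
  unfolding face_of_def
proof (intro conjI ballI impI)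
  show "cube_face J w \<subseteq> cube_polytope" by (auto simp: cube_face_def)
  have "convex (cube_polytope \<inter> (\<Inter>i\<in>- J. {x. x $ i = cube_vertex w $ i}))"
  proof (intro convex_Int convex_INT)
    show "convex cube_polytope" by (simp add: cube_polytope_def)
    show "convex {x. x $ i = cube_vertex w $ i}" for i
      by (simp add: convex_def distrib_right[symmetric])
  qed
  moreover have "cube_face J w = cube_polytope \<inter> (\<Inter>i\<in>- J. {x. x $ i = cube_vertex w $ i})"
    by (auto simp: cube_face_def)
  ultimately show "convex (cube_face J w)" by simp
  fix a b x
  assume ab: "a \<in> cube_polytope" "b \<in> cube_polytope" and x: "x \<in> cube_face J w" "x \<in> open_segment a b"
  obtain u where u: "0 < u" "u < 1" "x = (1 - u) *\<^sub>R a + u *\<^sub>R b"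
    using x(2) by (auto simp: in_segment)
  have "a $ i = cube_vertex w $ i \<and> b $ i = cube_vertex w $ i" if "i \<notin> J" for i
  proof -
    define c where "c = cube_vertex w $ i"
    have c: "c * c = 1" by (simp add: c_def cube_vertex_def)
    have le: "c * a $ i \<le> 1" "c * b $ i \<le> 1"
      using cube_coordinate_bound[OF ab(1), of i] cube_coordinate_bound[OF ab(2), of i]
      by (auto simp: c_def cube_vertex_def abs_le_iff)
    have "x $ i = c" using x(1) that by (simp add: cube_face_def c_def)
    then have "(1 - u) * a $ i + u * b $ i = c" using u(3) by simp
    then have "c * ((1 - u) * a $ i + u * b $ i) = 1" using c by simp
    then have "(1 - u) * (1 - c * a $ i) + u * (1 - c * b $ i) = 0" by (simp add: algebra_simps)
    moreover have "0 \<le> (1 - u) * (1 - c * a $ i)" "0 \<le> u * (1 - c * b $ i)"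
      using u le by simp_all
    ultimately have "(1 - u) * (1 - c * a $ i) = 0" "u * (1 - c * b $ i) = 0" by linarith+
    then have "c * a $ i = 1" "c * b $ i = 1" using u by simp_all
    moreover have "c = 1 \<or> c = - 1" by (simp add: c_def cube_vertex_def)
    ultimately show ?thesis unfolding c_def[symmetric] by (elim disjE) simp_all
  qed
  then show "a \<in> cube_face J w" "b \<in> cube_face J w" using ab by (simp_all add: cube_face_def)
qed

lemma cube_vertex_in_face: "cube_vertex b \<in> cube_face J w \<longleftrightarrow> b \<in> subcube J w"
proof -
  have "cube_vertex b $ i = cube_vertex w $ i \<longleftrightarrow> b i = w i" for i
    by (simp add: cube_vertex_def)
  then show ?thesis by (simp add: cube_face_def subcube_def cube_vertex_in_cube)
qed

lemma extreme_points_of_cube: "x extreme_point_of cube_polytope \<longleftrightarrow> x \<in> range cube_vertex"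
proof
  show "x \<in> range cube_vertex" if "x extreme_point_of cube_polytope"
    using that unfolding cube_polytope_def range_cube_vertex by (rule extreme_point_of_convex_hull)
  assume "x \<in> range cube_vertex"
  then obtain b where b: "x = cube_vertex b" by blast
  have "cube_face {} b = {x}"
    using cube_vertex_in_cube[of b] by (auto simp: cube_face_def b vec_eq_iff)
  then show "x extreme_point_of cube_polytope"
    using cube_face_face_of[of "{}" b] by (simp add: face_of_singleton)
qed

lemma polytope_cube: "polytope (cube_polytope :: (real ^ 'n) set)"
  unfolding polytope_def cube_polytope_def range_cube_vertex
  by (intro exI[of _ "range cube_vertex"] conjI refl) simp

text \<open>Makes vertices visible in the face lattice: they are exactly the minimal nonempty faces.\<close>

lemma face_contains_vertex:
  fixes P :: "'a::euclidean_space set"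
  assumes "polytope P" "F face_of P" "F \<noteq> {}"
  obtains p where "p \<in> F" "{p} face_of P"
proof -
  have "compact F" "convex F"
    using assms(1,2) face_of_polytope_polytope polytope_imp_compact polytope_imp_convex by blast+
  then obtain p where p: "p extreme_point_of F" using extreme_point_exists_convex assms(3) by blast
  then have "p \<in> F" "{p} face_of P"
    using extreme_point_of_face[OF assms(2)] by (auto simp: face_of_singleton)
  then show thesis by (rule that)
qed

text \<open>Let \<open>\<phi>\<close> be the isomorphism of face lattices.  Minimal nonempty faces correspond, which gives the
bijection \<open>f\<close>.  The preimage \<open>G\<close> of an edge of the cube has exactly two vertices, hence is the segment
between them by the Krein-Milman theorem.\<close>

lemma cube_graph_in_polytope_graph:
  fixes P :: "'a::euclidean_space set"
  assumes P: "polytope P" and equiv: "comb_equiv P (cube_polytope :: (real ^ 'n) set)"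
  obtains f :: "('n::finite \<Rightarrow> bool) \<Rightarrow> 'a" where "inj f"
    "range f = {v. v extreme_point_of P}"
    "\<forall>b c. adj b c \<longrightarrow> closed_segment (f b) (f c) edge_of P"
proof -
  let ?Q = "cube_polytope :: (real ^ 'n) set"
  obtain \<phi> where bij: "bij_betw \<phi> {F. F face_of P} {F. F face_of ?Q}"
    and mono: "\<forall>F G. F face_of P \<longrightarrow> G face_of P \<longrightarrow> (F \<subseteq> G \<longleftrightarrow> \<phi> F \<subseteq> \<phi> G)"
    using equiv unfolding comb_equiv_def by (elim exE conjE)
  have face: "\<phi> F face_of ?Q" if "F face_of P" for F
    using bij that by (auto simp: bij_betw_def)
  have pre: "\<exists>F. F face_of P \<and> \<phi> F = E" if "E face_of ?Q" for E
  proof -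
    have "E \<in> \<phi> ` {F. F face_of P}" using bij that by (simp add: bij_betw_def)
    then show ?thesis by auto
  qed
  have sub: "F \<subseteq> G \<longleftrightarrow> \<phi> F \<subseteq> \<phi> G" if "F face_of P" "G face_of P" for F G
    using mono that by blast
  have empty: "\<phi> {} = {}"
  proof -
    obtain F where F: "F face_of P" "\<phi> F = {}" using pre[of "{}"] by auto
    then have "\<phi> {} \<subseteq> \<phi> F" using sub[of "{}" F] by simp
    then show ?thesis using F by simp
  qed
  have nonempty: "\<phi> F \<noteq> {}" if "F face_of P" "F \<noteq> {}" for F
    using sub[of F "{}"] that empty by auto
  have "\<exists>p. {p} face_of P \<and> \<phi> {p} = {cube_vertex b}" for b
  proof -
    have "{cube_vertex b} face_of ?Q" by (simp add: face_of_singleton extreme_points_of_cube)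
    then obtain F where F: "F face_of P" "\<phi> F = {cube_vertex b}" using pre by blast
    then have "F \<noteq> {}" using empty by auto
    then obtain p where p: "p \<in> F" "{p} face_of P" using face_contains_vertex[OF P F(1)] by blast
    then have "\<phi> {p} \<subseteq> {cube_vertex b}" using sub[OF p(2) F(1)] F(2) by simp
    moreover have "\<phi> {p} \<noteq> {}" using nonempty[OF p(2)] by simp
    ultimately show ?thesis using p(2) by blast
  qed
  then obtain f where f: "\<And>b. {f b} face_of P" "\<And>b. \<phi> {f b} = {cube_vertex b}" by metis
  have "inj f"
  proof (rule injI)
    fix b c assume "f b = f c"
    then have "{cube_vertex b} = {cube_vertex c}" using f(2) by metis
    then show "b = c" by simp
  qed
  have extreme: "f b extreme_point_of P" for b using f(1) by (simp add: face_of_singleton)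
  have all: "\<exists>b. p = f b" if p: "p extreme_point_of P" for p
  proof -
    have pf: "{p} face_of P" using p by (simp add: face_of_singleton)
    obtain v where v: "v \<in> \<phi> {p}" "{v} face_of ?Q"
      using face_contains_vertex[OF polytope_cube face[OF pf] nonempty[OF pf]] by blast
    then obtain b where "v = cube_vertex b" by (auto simp: face_of_singleton extreme_points_of_cube)
    then have "\<phi> {f b} \<subseteq> \<phi> {p}" using v f(2) by simp
    then have "{f b} \<subseteq> {p}" using sub[OF f(1) pf] by blast
    then show ?thesis by auto
  qed
  have range: "range f = {v. v extreme_point_of P}" using extreme all by blast
  have edge: "closed_segment (f b) (f (flip i b)) edge_of P" for b i
  proof -
    obtain G where G: "G face_of P" "\<phi> G = cube_face {i} b" using pre[OF cube_face_face_of] by blast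
    have mem: "f c \<in> G \<longleftrightarrow> c = b \<or> c = flip i b" for c
    proof -
      have "f c \<in> G \<longleftrightarrow> \<phi> {f c} \<subseteq> \<phi> G" using sub[OF f(1) G(1)] by simp
      also have "\<dots> \<longleftrightarrow> c \<in> subcube {i} b" by (simp add: f(2) G(2) cube_vertex_in_face)
      also have "\<dots> \<longleftrightarrow> c = b \<or> c = flip i b"
        unfolding subcube_insert_split[of i "{}" b] by (auto simp: subcube_def)
      finally show ?thesis .
    qed
    have "{x. x extreme_point_of G} = {f b, f (flip i b)}"
    proof (intro set_eqI iffI)
      fix x assume "x \<in> {x. x extreme_point_of G}"
      then have "x extreme_point_of P" "x \<in> G" using extreme_point_of_face[OF G(1)] by auto
      then show "x \<in> {f b, f (flip i b)}" using all[of x] mem by auto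
    next
      fix x assume "x \<in> {f b, f (flip i b)}"
      then show "x \<in> {x. x extreme_point_of G}"
        using extreme extreme_point_of_face[OF G(1)] mem by auto
    qed
    moreover have "compact G" "convex G"
      using P G(1) face_of_polytope_polytope polytope_imp_compact polytope_imp_convex by blast+
    then have "G = convex hull {x. x extreme_point_of G}" by (rule Krein_Milman_Minkowski)
    ultimately have "G = closed_segment (f b) (f (flip i b))" by (simp add: segment_convex_hull)
    moreover have "f b \<noteq> f (flip i b)" using inj_eq[OF \<open>inj f\<close>] by simp
    then have "aff_dim (closed_segment (f b) (f (flip i b))) = 1"
      by (simp add: segment_convex_hull aff_dim_convex_hull)
    ultimately show ?thesis using G(1) by (simp add: edge_of_def)
  qed
  have "\<forall>b c. adj b c \<longrightarrow> closed_segment (f b) (f c) edge_of P"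
    unfolding adj_def using edge by blast
  with \<open>inj f\<close> range show thesis by (rule that)
qed

lemma joined_vpath:
  assumes arcs: "\<And>b c. adj b c \<Longrightarrow> (f b, f c) \<in> arcs_ends G" and verts: "range f \<subseteq> verts G"
    and joined: "joined C u v"
  shows "\<exists>L. vpath L G \<and> hd L = f u \<and> last L = f v \<and> set L \<subseteq> f ` C"
proof -
  have u: "u \<in> C" using joined by (simp add: joined_def)
  have "(\<lambda>a b. adj a b \<and> b \<in> C)\<^sup>*\<^sup>* u v" using joined by (simp add: joined_def)
  then have "\<exists>L. vwalk L G \<and> hd L = f u \<and> last L = f v \<and> set L \<subseteq> f ` insert u C"
  proof (induction rule: converse_rtranclp_induct)
    case base
    have "vwalk [f v] G" using verts by (auto simp: vwalk_def)
    then show ?case by (intro exI[of _ "[f v]"]) auto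
  next
    case (step y z)
    then obtain L where L: "vwalk L G" "hd L = f z" "last L = f v" "set L \<subseteq> f ` insert z C" by blast
    have "vwalk (f y # L) G"
      using L(1,2) arcs[of y z] step(1) verts by (intro vwalk_consI) auto
    then show ?case
      using L step(1) by (intro exI[of _ "f y # L"]) (auto simp: vwalk_def)
  qed
  then obtain L where "vwalk L G \<and> hd L = f u \<and> last L = f v \<and> set L \<subseteq> f ` C"
    unfolding insert_absorb[OF u] by (elim exE)
  then have L: "vwalk L G" "hd L = f u" "last L = f v" "set L \<subseteq> f ` C" by simp_all
  have "set (vwalk_to_vpath L) \<subseteq> set L" using vwalk_to_vpath_subset by (rule subsetI)
  then have "set (vwalk_to_vpath L) \<subseteq> f ` C" using L(4) by (rule order_trans)
  then show ?thesis
    using L vwalk_to_vpath_vpath[OF L(1)] vwalk_to_vpath_hd[of L] vwalk_to_vpath_last[of L]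
    by (intro exI[of _ "vwalk_to_vpath L"]) simp
qed

theorem theorem18:
  fixes P :: "'a::euclidean_space set" and d :: nat
  assumes "CARD('n::finite) = d" and "d \<ge> 1" and "d \<noteq> 3"
    and "polytope P" and "comb_equiv P (cube_polytope :: (real ^ 'n) set)"
  shows "k_linked ((d + 1) div 2) (with_proj (polytope_graph P))"
proof -
  let ?G = "with_proj (polytope_graph P)"
  define k where "k = (d + 1) div 2"
  have k: "2 * k \<le> d + 1" by (simp add: k_def)
  obtain f :: "('n \<Rightarrow> bool) \<Rightarrow> 'a" where f: "inj f"
    "range f = {v. v extreme_point_of P}"
    "\<forall>b c. adj b c \<longrightarrow> closed_segment (f b) (f c) edge_of P"
    using cube_graph_in_polytope_graph[OF assms(4,5)] .
  have verts: "verts ?G = range f" by (simp add: polytope_graph_def f(2))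
  have extreme: "f b extreme_point_of P" for b using f(2) by blast
  have arcs: "(f b, f c) \<in> arcs_ends ?G" if "adj b c" for b c
    using f(3) that extreme by (auto simp: polytope_graph_def arcs_ends_def arc_to_ends_def)
  have "linkable (UNIV :: 'n set)" using assms(1,3) by (intro linkable_subcube) simp
  show ?thesis
    unfolding k_linked_def k_def[symmetric]
  proof (intro conjI allI impI)
    have "card (verts ?G) = 2 ^ d"
      unfolding verts using assms(1,2) by (simp add: card_image[OF f(1)] card_fun)
    moreover have "d + 1 \<le> 2 ^ d" using less_exp[of d] by (simp add: Suc_le_eq)
    ultimately show "2 * k \<le> card (verts ?G)" using k by linarith
  next
    fix s t
    assume st: "s ` {..<k} \<subseteq> verts ?G \<and> t ` {..<k} \<subseteq> verts ?G \<and>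
      inj_on s {..<k} \<and> inj_on t {..<k} \<and> s ` {..<k} \<inter> t ` {..<k} = {}"
    define p q where "p = inv f \<circ> s" and "q = inv f \<circ> t"
    have fp: "f (p i) = s i" "f (q i) = t i" if "i < k" for i
    proof -
      have "s i \<in> range f" "t i \<in> range f" using st that unfolding verts by blast+
      then show "f (p i) = s i" "f (q i) = t i" by (simp_all add: p_def q_def f_inv_into_f)
    qed
    have "disjoint_pairs {..<k} p q"
      unfolding disjoint_pairs_def
    proof (intro ballI impI)
      fix i j assume ij: "i \<in> {..<k}" "j \<in> {..<k}" "i \<noteq> j"
      have "s i \<noteq> s j" "t i \<noteq> t j" using st ij by (auto dest: inj_onD)
      moreover have "s i \<noteq> t j" "t i \<noteq> s j" using st ij by blast+
      ultimately have "f (p i) \<noteq> f (p j)" "f (q i) \<noteq> f (q j)" "f (p i) \<noteq> f (q j)" "f (q i) \<noteq> f (p j)"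
        using fp(1)[of i] fp(1)[of j] fp(2)[of i] fp(2)[of j] ij by simp_all
      then show "{p i, q i} \<inter> {p j, q j} = {}" by auto
    qed
    moreover have "card (terminals {..<k} p q) \<le> card (UNIV :: 'n set) + 1"
    proof -
      have "card (terminals {..<k} p q) \<le> card (p ` {..<k}) + card (q ` {..<k})"
        unfolding terminals_def by (rule card_Un_le)
      also have "\<dots> \<le> card {..<k} + card {..<k}" by (intro add_mono card_image_le) auto
      finally show ?thesis using k assms(1) by simp
    qed
    ultimately have "linked (subcube UNIV (\<lambda>_. False)) {..<k} p q"
      by (intro linkableD[OF \<open>linkable UNIV\<close>]) (auto simp: subcube_def)
    then obtain C where C: "\<forall>i\<in>{..<k}. C i \<subseteq> subcube UNIV (\<lambda>_. False) \<and> joined (C i) (p i) (q i)"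
      "\<forall>i\<in>{..<k}. \<forall>j\<in>{..<k}. i \<noteq> j \<longrightarrow> C i \<inter> C j = {}"
      by (rule linkedE)
    have "\<exists>L. vpath L ?G \<and> hd L = s i \<and> last L = t i \<and> set L \<subseteq> f ` C i" if "i < k" for i
      using joined_vpath[of f ?G "C i" "p i" "q i"] arcs verts C(1) fp[OF that] that by simp
    then obtain L where L: "\<forall>i<k. vpath (L i) ?G \<and> hd (L i) = s i \<and> last (L i) = t i \<and> set (L i) \<subseteq> f ` C i"
      by metis
    have "set (L i) \<inter> set (L j) = {}" if "i < k" "j < k" "i \<noteq> j" for i j
    proof -
      have "f ` C i \<inter> f ` C j = {}"
        using C(2) that by (simp add: image_Int[OF f(1), symmetric])
      moreover have "set (L i) \<subseteq> f ` C i" "set (L j) \<subseteq> f ` C j" using L that by simp_all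
      ultimately show ?thesis by auto
    qed
    then have "\<forall>i<k. \<forall>j<k. i \<noteq> j \<longrightarrow> set (L i) \<inter> set (L j) = {}" by simp
    moreover have "\<forall>i<k. vpath (L i) ?G \<and> hd (L i) = s i \<and> last (L i) = t i" using L by simp
    ultimately show "\<exists>L. (\<forall>i<k. vpath (L i) ?G \<and> hd (L i) = s i \<and> last (L i) = t i) \<and>
        (\<forall>i<k. \<forall>j<k. i \<noteq> j \<longrightarrow> set (L i) \<inter> set (L j) = {})"
      by (intro exI[of _ L] conjI)
  qed
qed

end
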